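(* Let $X_1,\ldots,X_n$ be independent mean zero real-valued random variables with $\|X_i\|_{\psi_\alpha}<\infty$ for all $1\le i\le n$ and some $\alpha>0$. Let $a=(a_1,\ldots,a_n)\in\mathbb{R}^n$ and set $b=(a_1\|X_1\|_{\psi_\alpha},\ldots,a_n\|X_n\|_{\psi_\alpha})\in\mathbb{R}^n$, with $b\neq 0$. Define $$C(\alpha):=\max\{\sqrt2,2^{1/\alpha}\}\times\begin{cases}\sqrt8\,e^3(2\pi)^{1/4}e^{1/24}(e^{2/e}/\alpha)^{1/\alpha},&\text{if }\alpha<1,\\ 4e+2(\log 2)^{1/\alpha},&\text{if }\alpha\ge1,\end{cases}$$ let $\beta(\alpha)=\infty$ when $\alpha\le1$ and $\beta(\alpha)=\alpha/(\alpha-1)$ when $\alpha>1$, and define $$L_n(\alpha):=\frac{4^{1/\alpha}}{\sqrt2\,\|b\|_2}\times\begin{cases}\|b\|_{\beta(\alpha)},&\text{if }\alpha<1,\\ 4e\|b\|_{\beta(\alpha)}/C(\alpha),&\text{if }\alpha\ge1,\end{cases}\qquad L_n^*(\alpha):=\frac{L_n(\alpha)C(\alpha)\|b\|_2}{\|b\|_{\beta(\alpha)}}.$$ Then $$\Big\|\sum_{i=1}^n a_iX_i\Big\|_{\Psi_{\alpha,L_n(\alpha)}}\le 2eC(\alpha)\|b\|_2,$$ and $$\mathbb{P}\Big(\Big|\sum_{i=1}^n a_iX_i\Big|\ge 2eC(\alpha)\|b\|_2\sqrt t+2eL_n^*(\alpha)t^{1/\alpha}\|b\|_{\beta(\alpha)}\Big)\le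 2e^{-t}\quad\text{for all }t\ge0.$$
   Context: For a non-decreasing $g:[0,\infty)\to[0,\infty)$ with $g(0)=0$, the $g$-Orlicz norm of a real random variable $X$ is $\|X\|_g:=\inf\{\eta>0:\mathbb{E}[g(|X|/\eta)]\le1\}$. For $\alpha>0$, $\psi_\alpha(x):=\exp(x^\alpha)-1$, $x\ge0$. For $\alpha>0$, $L\ge0$, the function $\Psi_{\alpha,L}:[0,\infty)\to[0,\infty)$ is defined through its inverse $\Psi_{\alpha,L}^{-1}(t):=\sqrt{\log(1+t)}+L(\log(1+t))^{1/\alpha}$, $t\ge0$, and $\|X\|_{\Psi_{\alpha,L}}$ is the $g$-Orlicz norm with $g=\Psi_{\alpha,L}$ (Generalized Bernstein-Orlicz norm). For $x\in\mathbb{R}^n$, $\|x\|_r=(\sum_j|x_j|^r)^{1/r}$ and $\|x\|_\infty=\max_j|x_j|$. *)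

theory Defs
  imports "HOL-Probability.Probability"
begin

text \<open>
  The norm takes values in the extended nonnegative reals, so that it is \<open>\<infinity>\<close> (the infimum of the
  empty set) when no admissible \<open>\<eta>\<close> exists. The expectation of the nonnegative variable
  \<open>g (\<bar>X\<bar> / \<eta>)\<close> is the nonnegative integral, because it may be infinite.
\<close>

definition orlicz_norm :: "'w measure \<Rightarrow> (real \<Rightarrow> real) \<Rightarrow> ('w \<Rightarrow> real) \<Rightarrow> ennreal" where
  "orlicz_norm M g X =
     Inf {ennreal \<eta> |\<eta>. 0 < \<eta> \<and> (\<integral>\<^sup>+\<omega>. ennreal (g (\<bar>X \<omega>\<bar> / \<eta>)) \<partial>M) \<le> 1}"

definition psi :: "real \<Rightarrow> real \<Rightarrow> real" where
  "psi \<alpha> x = exp (x powr \<alpha>) - 1"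

definition Psi_inv :: "real \<Rightarrow> real \<Rightarrow> real \<Rightarrow> real" where
  "Psi_inv \<alpha> L t = sqrt (ln (1 + t)) + L * ln (1 + t) powr (1 / \<alpha>)"

text \<open>
  Meaningful on \<open>{0..}\<close> for \<open>\<alpha> > 0\<close> and \<open>L \<ge> 0\<close>; see \<open>bij_betw_Psi_inv\<close> below.
\<close>

definition Psi :: "real \<Rightarrow> real \<Rightarrow> real \<Rightarrow> real" where
  "Psi \<alpha> L = the_inv_into {0..} (Psi_inv \<alpha> L)"

lemma Psi_inv_strict_mono_on:
  assumes "\<alpha> > 0" "L \<ge> 0"
  shows "strict_mono_on {0..} (Psi_inv \<alpha> L)"
proof (rule strict_mono_onI)
  fix s t :: real
  assume st: "s \<in> {0..}" "t \<in> {0..}" "s < t"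
  have ln: "0 \<le> ln (1 + s)" "ln (1 + s) < ln (1 + t)"
    using st by auto
  have "ln (1 + s) powr (1 / \<alpha>) \<le> ln (1 + t) powr (1 / \<alpha>)"
    using ln assms by (intro powr_mono2) auto
  then have "L * ln (1 + s) powr (1 / \<alpha>) \<le> L * ln (1 + t) powr (1 / \<alpha>)"
    using assms by (intro mult_left_mono)
  moreover have "sqrt (ln (1 + s)) < sqrt (ln (1 + t))"
    using ln by simp
  ultimately show "Psi_inv \<alpha> L s < Psi_inv \<alpha> L t"
    unfolding Psi_inv_def by linarith
qed

lemma bij_betw_Psi_inv:
  assumes "\<alpha> > 0" "L \<ge> 0"
  shows "bij_betw (Psi_inv \<alpha> L) {0..} {0..}"
  unfolding bij_betw_def
proof
  show "inj_on (Psi_inv \<alpha> L) {0..}"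
    using Psi_inv_strict_mono_on[OF assms] by (rule strict_mono_on_imp_inj_on)
  show "Psi_inv \<alpha> L ` {0..} = {0..}"
  proof
    show "Psi_inv \<alpha> L ` {0..} \<subseteq> {0..}"
      using assms by (auto simp: Psi_inv_def)
    show "{0..} \<subseteq> Psi_inv \<alpha> L ` {0..}"
    proof
      fix y :: real
      assume y: "y \<in> {0..}"
      define T where "T = exp (y\<^sup>2) - 1"
      have T: "T \<ge> 0" by (simp add: T_def)
      have "sqrt (ln (1 + T)) = y"
        using y by (simp add: T_def)
      then have "y \<le> Psi_inv \<alpha> L T"
        using assms by (simp add: Psi_inv_def)
      moreover have "Psi_inv \<alpha> L 0 \<le> y"
        using y by (simp add: Psi_inv_def)
      moreover have "continuous_on {0..T} (Psi_inv \<alpha> L)"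
        unfolding Psi_inv_def using assms
        by (intro continuous_intros continuous_on_powr') auto
      ultimately obtain t where "0 \<le> t" "Psi_inv \<alpha> L t = y"
        using IVT'[of "Psi_inv \<alpha> L" 0 y T] T by blast
      then show "y \<in> Psi_inv \<alpha> L ` {0..}" by force
    qed
  qed
qed

lemma Psi_Psi_inv:
  assumes "\<alpha> > 0" "L \<ge> 0" "t \<ge> 0"
  shows "Psi \<alpha> L (Psi_inv \<alpha> L t) = t"
  using bij_betw_Psi_inv[OF assms(1,2)] assms(3)
  by (simp add: Psi_def bij_betw_def the_inv_into_f_f)

text \<open>
  A vector of \<open>\<real>\<^sup>n\<close> is a function on \<open>{1..n}\<close>; values outside that range are irrelevant.
  The exponent \<open>r\<close> may be \<open>\<infinity>\<close>.
\<close>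

definition lr_norm :: "nat \<Rightarrow> ereal \<Rightarrow> (nat \<Rightarrow> real) \<Rightarrow> real" where
  "lr_norm n r x =
     (if r = \<infinity> then (MAX j\<in>{1..n}. \<bar>x j\<bar>)
      else (\<Sum>j=1..n. \<bar>x j\<bar> powr real_of_ereal r) powr (1 / real_of_ereal r))"

definition beta_exp :: "real \<Rightarrow> ereal" where
  "beta_exp \<alpha> = (if \<alpha> \<le> 1 then \<infinity> else ereal (\<alpha> / (\<alpha> - 1)))"

definition C_const :: "real \<Rightarrow> real" where
  "C_const \<alpha> = max (sqrt 2) (2 powr (1 / \<alpha>)) *
     (if \<alpha> < 1
      then sqrt 8 * exp 1 ^ 3 * (2 * pi) powr (1 / 4) * exp (1 / 24)
             * (exp (2 / exp 1) / \<alpha>) powr (1 / \<alpha>)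
      else 4 * exp 1 + 2 * ln 2 powr (1 / \<alpha>))"

definition L_const :: "nat \<Rightarrow> (nat \<Rightarrow> real) \<Rightarrow> real \<Rightarrow> real" where
  "L_const n b \<alpha> = 4 powr (1 / \<alpha>) / (sqrt 2 * lr_norm n 2 b) *
     (if \<alpha> < 1 then lr_norm n (beta_exp \<alpha>) b
      else 4 * exp 1 * lr_norm n (beta_exp \<alpha>) b / C_const \<alpha>)"

definition L_star :: "nat \<Rightarrow> (nat \<Rightarrow> real) \<Rightarrow> real \<Rightarrow> real" where
  "L_star n b \<alpha> = L_const n b \<alpha> * C_const \<alpha> * lr_norm n 2 b / lr_norm n (beta_exp \<alpha>) b"

end

theory Submission
  imports Defs
begin

text \<open>
  Dividing \<open>X i\<close> by its norm gives \<open>Y i\<close> with \<open>E exp (\<bar>Y i\<bar> powr \<alpha>) \<le> 2\<close>, because the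
  infimum that defines the norm is attained (Fatou). The sum in question is then almost surely
  \<open>T = (\<Sum>i. b i * Y i)\<close>. Write \<open>N = \<parallel>b\<parallel>\<^sub>2\<close>, \<open>D = \<parallel>b\<parallel>\<close> in the norm with exponent \<open>\<beta>(\<alpha>)\<close>,
  \<open>C = C(\<alpha>)\<close>, \<open>L = L\<^sub>n(\<alpha>)\<close> and \<open>\<eta> = 2 e C N\<close>. Everything rests on one tail bound, with exponential
  rate 3:
  \<open>P(\<bar>T\<bar> \<ge> \<eta> (sqrt s + L s powr (1/\<alpha>))) \<le> 2 exp (-3 s)\<close> for \<open>s \<ge> 0\<close>
  (\<open>tail_sum_normalised\<close>). As \<open>L\<^sub>n\<^sup>*(\<alpha>) D = L C N\<close>, the threshold is the one in the claim,
  where only rate 1 is asserted. With \<open>s = ln (1 + u)\<close> the rate 3 says that \<open>\<Psi>(\<bar>T\<bar> / \<eta>)\<close> exceeds \<open>u\<close> with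
  probability at most \<open>2 / (1 + u)\<^sup>3\<close>, which integrates to exactly 1, and this is the bound on the
  Orlicz norm (\<open>orlicz_norm_Psi_le_if_tail\<close>).

  For \<open>\<alpha> \<ge> 1\<close> the tail bound is Chernoff's: the cumulant generating function of \<open>Y i\<close> at \<open>m\<close> is at
  most \<open>5 m\<^sup>2\<close> for \<open>\<bar>m\<bar> \<le> 1\<close>, by centring, and, if \<open>\<alpha> > 1\<close>, at most \<open>2 \<bar>m\<bar> powr \<beta>(\<alpha>)\<close> for
  \<open>\<bar>m\<bar> \<ge> 1\<close>, by Young's inequality (\<open>mgf_le\<close>). Hence at \<open>\<lambda> = min (sqrt s / N) (s powr (1 - 1/\<alpha>) / D)\<close> the cumulant
  generating function of \<open>T\<close> is at most \<open>7 s\<close>, while \<open>\<lambda>\<close> times the threshold is at least \<open>10 s\<close>.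

  For \<open>\<alpha> < 1\<close> exponential moments need not exist, and an even moment of order \<open>p\<close> comparable to \<open>s\<close>
  is used instead. A Weibull-type variable violates Bernstein's moment condition only through a factor
  that grows with the order, and up to the order \<open>p\<close> this factor can be frozen at its value for \<open>p\<close>
  (\<open>weibull_moment_factorial_bound\<close>). The moments of a sum are controlled through the truncated
  exponential series with the absolute values of the moments, which is submultiplicative over independent summands
  (\<open>moment_series_sum_le\<close>) and therefore replaces the moment generating function.
\<close>

section \<open>The infimum in the Orlicz norm is attained\<close>

lemma psi_mono: "0 \<le> \<alpha> \<Longrightarrow> 0 \<le> x \<Longrightarrow> x \<le> y \<Longrightarrow> psi \<alpha> x \<le> psi \<alpha> y"
  by (simp add: psi_def powr_mono2)

lemma orlicz_norm_less_imp_admissible: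
  assumes "\<alpha> > 0" and less: "orlicz_norm M (psi \<alpha>) X < ennreal \<eta>"
  shows "(\<integral>\<^sup>+\<omega>. ennreal (psi \<alpha> (\<bar>X \<omega>\<bar> / \<eta>)) \<partial>M) \<le> 1"
proof -
  from less obtain \<eta>' where \<eta>': "0 < \<eta>'" "ennreal \<eta>' < ennreal \<eta>"
    and le: "(\<integral>\<^sup>+\<omega>. ennreal (psi \<alpha> (\<bar>X \<omega>\<bar> / \<eta>')) \<partial>M) \<le> 1"
    unfolding orlicz_norm_def Inf_less_iff by blast
  have "\<eta>' < \<eta>" using \<eta>' by (simp add: ennreal_less_iff)
  have "(\<integral>\<^sup>+\<omega>. ennreal (psi \<alpha> (\<bar>X \<omega>\<bar> / \<eta>)) \<partial>M) \<le> (\<integral>\<^sup>+\<omega>. ennreal (psi \<alpha> (\<bar>X \<omega>\<bar> / \<eta>')) \<partial>M)"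
    using \<open>\<eta>' < \<eta>\<close> \<eta>'(1) assms(1)
    by (intro nn_integral_mono ennreal_leI psi_mono divide_left_mono mult_pos_pos) auto
  with le show ?thesis by simp
qed

text \<open>
  Every scale above the norm is admissible, so Fatou's lemma can be applied along scales that decrease
  to it. The statement keeps the \<open>liminf\<close>, because its value is read off differently for \<open>K = 0\<close>
  and for \<open>K > 0\<close>.
\<close>

lemma nn_integral_liminf_psi_le:
  fixes X :: "'w \<Rightarrow> real"
  assumes "\<alpha> > 0" and [measurable]: "X \<in> borel_measurable M"
    and fin: "orlicz_norm M (psi \<alpha>) X < \<infinity>"
  defines "K \<equiv> enn2real (orlicz_norm M (psi \<alpha>) X)"
  shows "(\<integral>\<^sup>+\<omega>. liminf (\<lambda>m. ennreal (psi \<alpha> (\<bar>X \<omega>\<bar> / (K + 1 / real (Suc m))))) \<partial>M) \<le> 1"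
proof -
  have K: "ennreal K = orlicz_norm M (psi \<alpha>) X"
    using fin by (simp add: K_def)
  have K0: "0 \<le> K" by (simp add: K_def)
  have le: "(\<integral>\<^sup>+\<omega>. ennreal (psi \<alpha> (\<bar>X \<omega>\<bar> / (K + 1 / real (Suc m)))) \<partial>M) \<le> 1" for m
    by (rule orlicz_norm_less_imp_admissible[OF assms(1)])
      (use K0 in \<open>simp add: K[symmetric] ennreal_less_iff\<close>)
  have meas: "(\<lambda>\<omega>. ennreal (psi \<alpha> (\<bar>X \<omega>\<bar> / (K + 1 / real (Suc m))))) \<in> borel_measurable M" for m
    unfolding psi_def by measurable
  have "(\<integral>\<^sup>+\<omega>. liminf (\<lambda>m. ennreal (psi \<alpha> (\<bar>X \<omega>\<bar> / (K + 1 / real (Suc m))))) \<partial>M)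
      \<le> liminf (\<lambda>m. \<integral>\<^sup>+\<omega>. ennreal (psi \<alpha> (\<bar>X \<omega>\<bar> / (K + 1 / real (Suc m)))) \<partial>M)"
    by (rule nn_integral_liminf[OF meas])
  also have "\<dots> \<le> liminf (\<lambda>m. 1 :: ennreal)"
    using le by (intro Liminf_mono) auto
  also have "\<dots> = 1" by (simp add: Liminf_const)
  finally show ?thesis .
qed

lemma filterlim_powr_at_top:
  assumes "(p :: real) > 0"
  shows "filterlim (\<lambda>x::real. x powr p) at_top at_top"
proof -
  have "filterlim (\<lambda>x::real. exp (p * ln x)) at_top at_top"
    using assms by (intro filterlim_compose[OF exp_at_top] ln_at_top
      filterlim_tendsto_pos_mult_at_top[OF tendsto_const])
  then show ?thesis
    by (rule filterlim_mono_eventually)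
      (auto intro: eventually_mono[OF eventually_gt_at_top[of 0]] simp: powr_def)
qed

text \<open>
  Where \<open>X\<close> does not vanish, \<open>psi \<alpha> (\<bar>X\<bar> / \<eta>)\<close> diverges as \<open>\<eta>\<close> tends to 0; as the \<open>liminf\<close> has a
  finite integral, this can happen only on a null set.
\<close>

lemma AE_eq_0_if_orlicz_norm_eq_0:
  fixes X :: "'w \<Rightarrow> real"
  assumes "\<alpha> > 0" and [measurable]: "X \<in> borel_measurable M"
    and zero: "orlicz_norm M (psi \<alpha>) X = 0"
  shows "AE \<omega> in M. X \<omega> = 0"
proof -
  define f where "f \<omega> = liminf (\<lambda>m. ennreal (psi \<alpha> (\<bar>X \<omega>\<bar> / (1 / real (Suc m)))))" for \<omega>
  have [measurable]: "f \<in> borel_measurable M"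
    unfolding f_def psi_def by measurable
  have "integral\<^sup>N M f \<le> 1"
    using nn_integral_liminf_psi_le[OF assms(1,2)] zero unfolding f_def by (simp del: of_nat_Suc)
  then have "AE \<omega> in M. f \<omega> \<noteq> \<infinity>"
    by (intro nn_integral_PInf_AE) (auto simp: top_unique)
  then show ?thesis
  proof eventually_elim
    case (elim \<omega>)
    show ?case
    proof (rule ccontr)
      assume nz: "X \<omega> \<noteq> 0"
      have "filterlim (\<lambda>m. \<bar>X \<omega>\<bar> * real (Suc m)) at_top sequentially"
        using nz by (intro filterlim_tendsto_pos_mult_at_top[OF tendsto_const]
            filterlim_compose[OF filterlim_real_sequentially filterlim_Suc]) simp
      then have "filterlim (\<lambda>m. (\<bar>X \<omega>\<bar> * real (Suc m)) powr \<alpha>) at_top sequentially"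
        by (rule filterlim_compose[OF filterlim_powr_at_top[OF assms(1)]])
      then have "filterlim (\<lambda>m. exp ((\<bar>X \<omega>\<bar> * real (Suc m)) powr \<alpha>)) at_top sequentially"
        by (rule filterlim_compose[OF exp_at_top])
      then have "filterlim (\<lambda>m. - 1 + exp ((\<bar>X \<omega>\<bar> * real (Suc m)) powr \<alpha>)) at_top sequentially"
        by (rule filterlim_tendsto_add_at_top[OF tendsto_const])
      then have "filterlim (\<lambda>m. psi \<alpha> (\<bar>X \<omega>\<bar> / (1 / real (Suc m)))) at_top sequentially"
        by (simp add: psi_def del: of_nat_Suc)
      then have "((\<lambda>m. ennreal (psi \<alpha> (\<bar>X \<omega>\<bar> / (1 / real (Suc m))))) \<longlongrightarrow> \<infinity>) sequentially"
        by (simp add: ennreal_tendsto_top_eq_at_top)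
      then have "f \<omega> = \<infinity>"
        unfolding f_def by (intro lim_imp_Liminf) auto
      with elim show False by simp
    qed
  qed
qed

text \<open>
  For \<open>K > 0\<close> the \<open>liminf\<close> above is a limit, by continuity of \<open>psi \<alpha>\<close>. For \<open>K = 0\<close> the quotient
  \<open>X \<omega> / K\<close> is 0 by the convention on division, which is the value wanted since \<open>X\<close> vanishes almost
  surely; so no summand has to be singled out later.
\<close>

lemma (in prob_space) nn_integral_exp_normalised_le_2:
  fixes X :: "'a \<Rightarrow> real"
  assumes "\<alpha> > 0" and [measurable]: "X \<in> borel_measurable M"
    and fin: "orlicz_norm M (psi \<alpha>) X < \<infinity>"
  defines "K \<equiv> enn2real (orlicz_norm M (psi \<alpha>) X)"
  shows "(\<integral>\<^sup>+\<omega>. ennreal (exp (\<bar>X \<omega> / K\<bar> powr \<alpha>)) \<partial>M) \<le> 2"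
proof (cases "K = 0")
  case True
  then show ?thesis using assms(1) by (simp add: emeasure_space_1)
next
  case False
  then have K: "K > 0" by (simp add: K_def enn2real_nonneg order_less_le)
  have lim: "liminf (\<lambda>m. ennreal (psi \<alpha> (\<bar>X \<omega>\<bar> / (K + 1 / real (Suc m))))) = ennreal (psi \<alpha> (\<bar>X \<omega>\<bar> / K))" for \<omega>
  proof (intro lim_imp_Liminf tendsto_ennrealI)
    have "(\<lambda>m. K + 1 / real (Suc m)) \<longlonglongrightarrow> K + 0"
      by (intro tendsto_add tendsto_const LIMSEQ_Suc[OF lim_1_over_n])
    then have "(\<lambda>m. \<bar>X \<omega>\<bar> / (K + 1 / real (Suc m))) \<longlonglongrightarrow> \<bar>X \<omega>\<bar> / K"
      using K by (intro tendsto_divide tendsto_const) auto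
    then show "(\<lambda>m. psi \<alpha> (\<bar>X \<omega>\<bar> / (K + 1 / real (Suc m)))) \<longlonglongrightarrow> psi \<alpha> (\<bar>X \<omega>\<bar> / K)"
      unfolding psi_def using K assms(1)
      by (intro tendsto_diff tendsto_exp tendsto_powr' tendsto_const) (auto simp del: of_nat_Suc)
  qed auto
  have "(\<integral>\<^sup>+\<omega>. ennreal (exp (\<bar>X \<omega> / K\<bar> powr \<alpha>)) \<partial>M)
      = (\<integral>\<^sup>+\<omega>. (ennreal (psi \<alpha> (\<bar>X \<omega>\<bar> / K)) + 1) \<partial>M)"
    using K by (intro nn_integral_cong)
      (simp add: psi_def abs_divide flip: ennreal_1 ennreal_plus)
  also have "\<dots> = (\<integral>\<^sup>+\<omega>. ennreal (psi \<alpha> (\<bar>X \<omega>\<bar> / K)) \<partial>M) + 1"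
    by (subst nn_integral_add) (auto simp: psi_def emeasure_space_1)
  also have "\<dots> \<le> 1 + 1"
    using nn_integral_liminf_psi_le[OF assms(1,2) fin] unfolding K_def[symmetric] lim
    by (intro add_right_mono)
  finally show ?thesis by simp
qed

section \<open>From tails to the Bernstein--Orlicz norm\<close>

text \<open>
  The layer-cake formula: \<open>f \<omega>\<close> is the length of \<open>{0..f \<omega>}\<close>, and Tonelli exchanges the integrals.
\<close>

lemma (in sigma_finite_measure) nn_integral_eq_integral_tails:
  fixes f :: "'a \<Rightarrow> real"
  assumes [measurable]: "f \<in> borel_measurable M" and nonneg: "\<And>\<omega>. 0 \<le> f \<omega>"
  shows "(\<integral>\<^sup>+\<omega>. ennreal (f \<omega>) \<partial>M)
       = (\<integral>\<^sup>+u. emeasure M {\<omega> \<in> space M. u \<le> f \<omega>} * indicator {0..} u \<partial>lborel)"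
proof -
  interpret lb: pair_sigma_finite lborel M ..
  define G :: "real \<Rightarrow> 'a \<Rightarrow> ennreal" where "G u \<omega> = (if 0 \<le> u \<and> u \<le> f \<omega> then 1 else 0)" for u \<omega>
  have G[measurable]: "case_prod G \<in> borel_measurable (lborel \<Otimes>\<^sub>M M)"
    unfolding G_def by measurable
  have "(\<integral>\<^sup>+\<omega>. ennreal (f \<omega>) \<partial>M) = (\<integral>\<^sup>+\<omega>. (\<integral>\<^sup>+u. G u \<omega> \<partial>lborel) \<partial>M)"
  proof (rule nn_integral_cong)
    fix \<omega>
    have "(\<integral>\<^sup>+u. G u \<omega> \<partial>lborel) = (\<integral>\<^sup>+u. indicator {0..f \<omega>} u \<partial>lborel)"
      by (intro nn_integral_cong) (auto simp: G_def)
    then show "ennreal (f \<omega>) = (\<integral>\<^sup>+u. G u \<omega> \<partial>lborel)"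
      using nonneg by simp
  qed
  also have "\<dots> = (\<integral>\<^sup>+u. (\<integral>\<^sup>+\<omega>. G u \<omega> \<partial>M) \<partial>lborel)"
    by (rule lb.Fubini'[OF G])
  also have "\<dots> = (\<integral>\<^sup>+u. emeasure M {\<omega> \<in> space M. u \<le> f \<omega>} * indicator {0..} u \<partial>lborel)"
  proof (rule nn_integral_cong)
    fix u :: real
    have "(\<integral>\<^sup>+\<omega>. G u \<omega> \<partial>M) = (\<integral>\<^sup>+\<omega>. indicator {0..} u * indicator {\<omega> \<in> space M. u \<le> f \<omega>} \<omega> \<partial>M)"
      by (intro nn_integral_cong) (auto simp: G_def)
    then show "(\<integral>\<^sup>+\<omega>. G u \<omega> \<partial>M) = emeasure M {\<omega> \<in> space M. u \<le> f \<omega>} * indicator {0..} u"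
      by (simp add: nn_integral_cmult mult.commute)
  qed
  finally show ?thesis .
qed

lemma nn_integral_inverse_cube:
  "(\<integral>\<^sup>+u. ennreal (2 / (1 + u) ^ 3) * indicator {0..} u \<partial>lborel) = 1"
proof -
  have "(\<integral>\<^sup>+u. ennreal (2 / (1 + u) ^ 3) * indicator {0..} u \<partial>lborel)
      = ennreal (0 - (- (1 / (1 + 0) ^ 2)))"
  proof (rule nn_integral_FTC_atLeast)
    show "(\<lambda>u::real. 2 / (1 + u) ^ 3) \<in> borel_measurable borel" by measurable
    show "((\<lambda>u. - (1 / (1 + u) ^ 2)) has_real_derivative 2 / (1 + u) ^ 3) (at u)" if "0 \<le> u" for u :: real
    proof -
      have "((\<lambda>u. - inverse ((1 + u) ^ 2)) has_real_derivative
          inverse ((1 + u) ^ 2) * (2 * (1 + u)) * inverse ((1 + u) ^ 2)) (at u)"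
        using that by (auto intro!: derivative_eq_intros)
      also have "inverse ((1 + u) ^ 2) * (2 * (1 + u)) * inverse ((1 + u) ^ 2) = 2 / (1 + u) ^ 3"
        using that by (simp add: divide_simps) (simp add: power_eq_if algebra_simps)
      finally show ?thesis by (simp add: inverse_eq_divide)
    qed
    have "filterlim (\<lambda>u::real. (1 + u) ^ 2) at_top at_top"
      by (intro filterlim_pow_at_top filterlim_tendsto_add_at_top[OF tendsto_const] filterlim_ident) auto
    then have "((\<lambda>u::real. inverse ((1 + u) ^ 2)) \<longlongrightarrow> 0) at_top"
      by (rule tendsto_inverse_0_at_top)
    from tendsto_minus[OF this] show "((\<lambda>u::real. - (1 / (1 + u) ^ 2)) \<longlongrightarrow> 0) at_top"
      by (simp add: inverse_eq_divide)
  qed auto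
  then show ?thesis by simp
qed

lemma Psi_range:
  assumes "\<alpha> > 0" "L \<ge> 0" "y \<ge> 0"
  shows Psi_nonneg: "Psi \<alpha> L y \<ge> 0" and Psi_inv_Psi: "Psi_inv \<alpha> L (Psi \<alpha> L y) = y"
proof -
  obtain t where "t \<ge> 0" "y = Psi_inv \<alpha> L t"
    using bij_betw_Psi_inv[OF assms(1,2)] assms(3) unfolding bij_betw_def by force
  then show "Psi \<alpha> L y \<ge> 0" "Psi_inv \<alpha> L (Psi \<alpha> L y) = y"
    using Psi_Psi_inv[OF assms(1,2)] by simp_all
qed

lemma le_Psi_iff:
  assumes "\<alpha> > 0" "L \<ge> 0" "y \<ge> 0" "u \<ge> 0"
  shows "u \<le> Psi \<alpha> L y \<longleftrightarrow> Psi_inv \<alpha> L u \<le> y"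
  using strict_mono_on_less_eq[OF Psi_inv_strict_mono_on[OF assms(1,2)], of u "Psi \<alpha> L y"]
    Psi_range[OF assms(1-3)] assms(4) by simp

text \<open>
  The substitution \<open>s = ln (1 + u)\<close> turns the threshold into \<open>\<eta> * Psi_inv \<alpha> L u\<close> and the bound
  \<open>2 * exp (- 3 * s)\<close> into \<open>2 / (1 + u) ^ 3\<close>, whose integral is 1. The rate 3 is the one for which
  the factor 2 in front is absorbed exactly.
\<close>

lemma (in prob_space) orlicz_norm_Psi_le_if_tail:
  fixes S :: "'a \<Rightarrow> real"
  assumes \<alpha>: "\<alpha> > 0" and L: "L \<ge> 0" and \<eta>: "\<eta> > 0" and S[measurable]: "S \<in> borel_measurable M"
    and tail: "\<And>s. s \<ge> 0 \<Longrightarrow>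
      prob {\<omega> \<in> space M. \<bar>S \<omega>\<bar> \<ge> \<eta> * (sqrt s + L * s powr (1 / \<alpha>))} \<le> 2 * exp (- 3 * s)"
  shows "orlicz_norm M (Psi \<alpha> L) S \<le> ennreal \<eta>"
proof -
  define f where "f \<omega> = Psi \<alpha> L (\<bar>S \<omega>\<bar> / \<eta>)" for \<omega>
  have f0: "0 \<le> f \<omega>" for \<omega>
    using \<alpha> L \<eta> by (simp add: f_def Psi_nonneg)
  have level: "{\<omega> \<in> space M. u \<le> f \<omega>} = {\<omega> \<in> space M. \<bar>S \<omega>\<bar> \<ge> \<eta> * Psi_inv \<alpha> L u}"
    if "u \<ge> 0" for u
    using that \<alpha> L \<eta> by (auto simp: f_def le_Psi_iff field_simps)
  have f[measurable]: "f \<in> borel_measurable M"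
  proof (rule borel_measurableI_ge)
    fix u :: real
    show "{\<omega> \<in> space M. u \<le> f \<omega>} \<in> sets M"
    proof (cases "u \<ge> 0")
      case True
      then show ?thesis unfolding level[OF True] by measurable
    next
      case False
      then have "{\<omega> \<in> space M. u \<le> f \<omega>} = space M" using f0 by (auto intro: order_trans[of u 0])
      then show ?thesis by simp
    qed
  qed
  have "emeasure M {\<omega> \<in> space M. u \<le> f \<omega>} \<le> ennreal (2 / (1 + u) ^ 3)" if u: "u \<ge> 0" for u
  proof -
    have "prob {\<omega> \<in> space M. u \<le> f \<omega>} \<le> 2 * exp (- 3 * ln (1 + u))"
      unfolding level[OF u] Psi_inv_def using u by (intro tail) auto
    also have "- 3 * ln (1 + u) = - ln ((1 + u) ^ 3)"
      using u by (simp add: ln_realpow)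
    also have "2 * exp (- ln ((1 + u) ^ 3)) = 2 / (1 + u) ^ 3"
      using u by (simp add: exp_minus field_simps)
    finally show ?thesis by (simp only: emeasure_eq_measure ennreal_leI)
  qed
  then have "(\<integral>\<^sup>+\<omega>. ennreal (f \<omega>) \<partial>M)
      \<le> (\<integral>\<^sup>+u. ennreal (2 / (1 + u) ^ 3) * indicator {0..} u \<partial>lborel)"
    unfolding nn_integral_eq_integral_tails[OF f f0]
    by (intro nn_integral_mono) (auto simp: indicator_def)
  then have "(\<integral>\<^sup>+\<omega>. ennreal (f \<omega>) \<partial>M) \<le> 1"
    by (simp only: nn_integral_inverse_cube)
  then show ?thesis
    unfolding orlicz_norm_def f_def using \<eta> by (intro Inf_lower) auto
qed

section \<open>Norms of vectors\<close>

lemma lr_norm_2: "lr_norm n 2 b = sqrt (\<Sum>i=1..n. (b i)\<^sup>2)"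
  by (simp add: lr_norm_def powr_half_sqrt sum_nonneg)

lemma lr_norm_2_pos:
  assumes "\<exists>i\<in>{1..n}. b i \<noteq> 0"
  shows "lr_norm n 2 b > 0"
proof -
  from assms obtain i where "i \<in> {1..n}" "0 < (b i)\<^sup>2" by auto
  then have "0 < (\<Sum>i=1..n. (b i)\<^sup>2)" by (intro sum_pos2) auto
  then show ?thesis unfolding lr_norm_2 by simp
qed

lemma abs_le_lr_norm_infinity: "i \<in> {1..n} \<Longrightarrow> \<bar>b i\<bar> \<le> lr_norm n \<infinity> b"
  unfolding lr_norm_def by (simp add: Max_ge)

lemma lr_norm_beta_exp_powr:
  assumes "\<alpha> > 1"
  shows "lr_norm n (beta_exp \<alpha>) b powr (\<alpha> / (\<alpha> - 1)) = (\<Sum>i=1..n. \<bar>b i\<bar> powr (\<alpha> / (\<alpha> - 1)))"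
  using assms by (simp add: lr_norm_def beta_exp_def powr_powr sum_nonneg)

lemma lr_norm_beta_exp_pos:
  assumes "\<exists>i\<in>{1..n}. b i \<noteq> 0"
  shows "lr_norm n (beta_exp \<alpha>) b > 0"
proof -
  from assms obtain i where i: "i \<in> {1..n}" "b i \<noteq> 0" by blast
  show ?thesis
  proof (cases "\<alpha> \<le> 1")
    case True
    then have "\<bar>b i\<bar> \<le> lr_norm n (beta_exp \<alpha>) b"
      using abs_le_lr_norm_infinity[OF i(1)] by (simp add: beta_exp_def)
    with i show ?thesis by linarith
  next
    case False
    have "0 < (\<Sum>i=1..n. \<bar>b i\<bar> powr (\<alpha> / (\<alpha> - 1)))"
      using i by (intro sum_pos2[of _ i]) auto
    with False show ?thesis by (simp add: lr_norm_def beta_exp_def)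
  qed
qed

section \<open>Exponents at least 1: Chernoff's method\<close>

text \<open>
  From the third term on, the exponential series of \<open>m * y\<close> is dominated by \<open>m\<^sup>2\<close> times that of \<open>\<bar>y\<bar>\<close>,
  since \<open>\<bar>m\<bar> ^ k \<le> m\<^sup>2\<close> for \<open>k \<ge> 2\<close>.
\<close>

lemma exp_mult_le_quadratic:
  fixes m y :: real
  assumes "\<bar>m\<bar> \<le> 1"
  shows "exp (m * y) \<le> 1 + m * y + m\<^sup>2 * (exp \<bar>y\<bar> - 1)"
proof -
  have sm: "summable (\<lambda>n. inverse (fact (n + 2)) *\<^sub>R z ^ (n + 2))" for z :: real
    by (intro iffD2[OF summable_iff_shift] summable_exp_generic) 
  have "(\<Sum>n. inverse (fact (n + 2)) *\<^sub>R (m * y) ^ (n + 2))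
      \<le> (\<Sum>n. m\<^sup>2 * (inverse (fact (n + 2)) *\<^sub>R \<bar>y\<bar> ^ (n + 2)))"
  proof (intro suminf_le summable_mult sm)
    fix n :: nat
    have "(m * y) ^ (n + 2) \<le> \<bar>m\<bar> ^ (n + 2) * \<bar>y\<bar> ^ (n + 2)"
      by (metis abs_ge_self abs_mult power_abs power_mult_distrib)
    also have "\<dots> \<le> \<bar>m\<bar> ^ 2 * \<bar>y\<bar> ^ (n + 2)"
      using assms by (intro mult_right_mono power_decreasing) auto
    finally have "inverse (fact (n + 2)) * (m * y) ^ (n + 2)
        \<le> inverse (fact (n + 2)) * (\<bar>m\<bar> ^ 2 * \<bar>y\<bar> ^ (n + 2))"
      by (intro mult_left_mono) auto
    then show "inverse (fact (n + 2)) *\<^sub>R (m * y) ^ (n + 2)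
        \<le> m\<^sup>2 * (inverse (fact (n + 2)) *\<^sub>R \<bar>y\<bar> ^ (n + 2))"
      by (simp only: real_scaleR_def power2_abs mult.left_commute)
  qed
  also have "\<dots> = m\<^sup>2 * (\<Sum>n. inverse (fact (n + 2)) *\<^sub>R \<bar>y\<bar> ^ (n + 2))"
    by (rule suminf_mult[OF sm])
  also have "\<dots> \<le> m\<^sup>2 * (exp \<bar>y\<bar> - 1)"
    using exp_first_two_terms[of "\<bar>y\<bar>"] by (intro mult_left_mono) auto
  finally show ?thesis using exp_first_two_terms[of "m * y"] by simp
qed

text \<open>
  Since \<open>\<bar>y\<bar> \<le> 1 + \<bar>y\<bar> powr \<alpha>\<close>, the variable \<open>exp \<bar>Y\<bar>\<close> has mean at most \<open>2 * 3 = 6\<close>, where 3 bounds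
  \<open>exp 1\<close>. Centring removes the linear term of the previous inequality, and \<open>6 - 1 = 5\<close> remains.
\<close>

lemma (in prob_space) mgf_le_quadratic:
  fixes Y :: "'a \<Rightarrow> real"
  assumes int: "integrable M Y" and mean: "expectation Y = 0"
    and \<alpha>: "\<alpha> \<ge> 1" and exp2: "(\<integral>\<^sup>+\<omega>. ennreal (exp (\<bar>Y \<omega>\<bar> powr \<alpha>)) \<partial>M) \<le> 2"
    and m: "\<bar>m\<bar> \<le> 1"
  shows "(\<integral>\<^sup>+\<omega>. ennreal (exp (m * Y \<omega>)) \<partial>M) \<le> ennreal (exp (5 * m\<^sup>2))"
proof -
  have [measurable]: "Y \<in> borel_measurable M" using int by auto
  have "(\<integral>\<^sup>+\<omega>. ennreal (exp \<bar>Y \<omega>\<bar>) \<partial>M) \<le> (\<integral>\<^sup>+\<omega>. 3 * ennreal (exp (\<bar>Y \<omega>\<bar> powr \<alpha>)) \<partial>M)"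
  proof (rule nn_integral_mono)
    fix \<omega>
    have "\<bar>Y \<omega>\<bar> \<le> 1 + \<bar>Y \<omega>\<bar> powr \<alpha>"
    proof (cases "\<bar>Y \<omega>\<bar> \<le> 1")
      case False
      then have "\<bar>Y \<omega>\<bar> powr 1 \<le> \<bar>Y \<omega>\<bar> powr \<alpha>" using \<alpha> by (intro powr_mono) auto
      with False show ?thesis by simp
    qed (use powr_ge_zero[of "\<bar>Y \<omega>\<bar>" \<alpha>] in linarith)
    then have "exp \<bar>Y \<omega>\<bar> \<le> exp 1 * exp (\<bar>Y \<omega>\<bar> powr \<alpha>)" by (simp flip: exp_add)
    also have "\<dots> \<le> 3 * exp (\<bar>Y \<omega>\<bar> powr \<alpha>)" using exp_le by (intro mult_right_mono) auto
    finally show "ennreal (exp \<bar>Y \<omega>\<bar>) \<le> 3 * ennreal (exp (\<bar>Y \<omega>\<bar> powr \<alpha>))"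
      by (simp add: ennreal_leI flip: ennreal_mult ennreal_numeral)
  qed
  also have "\<dots> = 3 * (\<integral>\<^sup>+\<omega>. ennreal (exp (\<bar>Y \<omega>\<bar> powr \<alpha>)) \<partial>M)"
    by (rule nn_integral_cmult) measurable
  also have "\<dots> \<le> 3 * 2" by (intro mult_left_mono exp2) auto
  finally have le6: "(\<integral>\<^sup>+\<omega>. ennreal (exp \<bar>Y \<omega>\<bar>) \<partial>M) \<le> ennreal 6" by simp
  have int_exp: "integrable M (\<lambda>\<omega>. exp \<bar>Y \<omega>\<bar>)"
    using le6 by (intro integrableI_nonneg) (auto intro: le_less_trans)
  have "expectation (\<lambda>\<omega>. exp \<bar>Y \<omega>\<bar>) \<le> 6"
    using le6 by (subst (asm) nn_integral_eq_integral[OF int_exp]) (auto simp del: ennreal_numeral)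
  then have E: "m\<^sup>2 * (expectation (\<lambda>\<omega>. exp \<bar>Y \<omega>\<bar>) - 1) \<le> m\<^sup>2 * 5"
    by (intro mult_left_mono) auto
  have int2: "integrable M (\<lambda>\<omega>. 1 + m * Y \<omega> + m\<^sup>2 * (exp \<bar>Y \<omega>\<bar> - 1))"
    using int int_exp by auto
  have "(\<integral>\<^sup>+\<omega>. ennreal (exp (m * Y \<omega>)) \<partial>M)
      \<le> (\<integral>\<^sup>+\<omega>. ennreal (1 + m * Y \<omega> + m\<^sup>2 * (exp \<bar>Y \<omega>\<bar> - 1)) \<partial>M)"
    by (intro nn_integral_mono ennreal_leI exp_mult_le_quadratic m)
  also have "\<dots> = ennreal (expectation (\<lambda>\<omega>. 1 + m * Y \<omega> + m\<^sup>2 * (exp \<bar>Y \<omega>\<bar> - 1)))"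
    using exp_mult_le_quadratic[OF m]
    by (intro nn_integral_eq_integral int2 AE_I2) (metis exp_ge_zero order_trans)
  also have "expectation (\<lambda>\<omega>. 1 + m * Y \<omega> + m\<^sup>2 * (exp \<bar>Y \<omega>\<bar> - 1))
      = 1 + m\<^sup>2 * (expectation (\<lambda>\<omega>. exp \<bar>Y \<omega>\<bar>) - 1)"
    using int int_exp by (simp add: mean prob_space)
  also have "ennreal \<dots> \<le> ennreal (exp (5 * m\<^sup>2))"
    using E exp_ge_add_one_self[of "5 * m\<^sup>2"] by (intro ennreal_leI) linarith
  finally show ?thesis .
qed

text \<open>
  Young's inequality \<open>m * y \<le> \<bar>y\<bar> powr \<alpha> / \<alpha> + \<bar>m\<bar> powr \<beta> / \<beta>\<close>, with both denominators dropped.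
\<close>

lemma (in prob_space) mgf_le_conjugate_power:
  fixes Y :: "'a \<Rightarrow> real"
  assumes [measurable]: "Y \<in> borel_measurable M"
    and \<alpha>: "\<alpha> > 1" and exp2: "(\<integral>\<^sup>+\<omega>. ennreal (exp (\<bar>Y \<omega>\<bar> powr \<alpha>)) \<partial>M) \<le> 2"
  shows "(\<integral>\<^sup>+\<omega>. ennreal (exp (m * Y \<omega>)) \<partial>M) \<le> ennreal (2 * exp (\<bar>m\<bar> powr (\<alpha> / (\<alpha> - 1))))"
proof -
  define \<beta> where "\<beta> = \<alpha> / (\<alpha> - 1)"
  have \<beta>: "\<beta> > 1" "1 / \<alpha> + 1 / \<beta> = 1" using \<alpha> by (auto simp: \<beta>_def field_simps)
  have "(\<integral>\<^sup>+\<omega>. ennreal (exp (m * Y \<omega>)) \<partial>M)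
      \<le> (\<integral>\<^sup>+\<omega>. ennreal (exp (\<bar>m\<bar> powr \<beta>)) * ennreal (exp (\<bar>Y \<omega>\<bar> powr \<alpha>)) \<partial>M)"
  proof (rule nn_integral_mono)
    fix \<omega>
    have "m * Y \<omega> \<le> \<bar>Y \<omega>\<bar> * \<bar>m\<bar>" by (metis abs_ge_self abs_mult mult.commute)
    also have "\<dots> \<le> \<bar>Y \<omega>\<bar> powr \<alpha> / \<alpha> + \<bar>m\<bar> powr \<beta> / \<beta>"
      using \<alpha> \<beta> by (intro Youngs_inequality) auto
    also have "\<dots> \<le> \<bar>Y \<omega>\<bar> powr \<alpha> / 1 + \<bar>m\<bar> powr \<beta> / 1"
      using \<alpha> \<beta> by (intro add_mono divide_left_mono) auto
    finally show "ennreal (exp (m * Y \<omega>)) \<le> ennreal (exp (\<bar>m\<bar> powr \<beta>)) * ennreal (exp (\<bar>Y \<omega>\<bar> powr \<alpha>))"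
      by (simp add: ennreal_leI add.commute flip: ennreal_mult exp_add)
  qed
  also have "\<dots> = ennreal (exp (\<bar>m\<bar> powr \<beta>)) * (\<integral>\<^sup>+\<omega>. ennreal (exp (\<bar>Y \<omega>\<bar> powr \<alpha>)) \<partial>M)"
    by (rule nn_integral_cmult) measurable
  also have "\<dots> \<le> ennreal (exp (\<bar>m\<bar> powr \<beta>)) * 2" by (intro mult_left_mono exp2) auto
  also have "\<dots> = ennreal (2 * exp (\<bar>m\<bar> powr \<beta>))"
    by (simp add: ennreal_mult mult.commute)
  finally show ?thesis by (simp add: \<beta>_def)
qed

text \<open>
  For \<open>\<alpha> > 1\<close> and \<open>\<bar>m\<bar> > 1\<close> the factor 2 from the conjugate bound is at most \<open>exp (\<bar>m\<bar> powr \<beta>)\<close>,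
  where \<open>\<beta> = \<alpha> / (\<alpha> - 1)\<close>. The exponent is then a sum of homogeneous terms in \<open>m\<close>, so that its sum
  over \<open>m = l * b i\<close> depends only on \<open>l\<close> and norms of \<open>b\<close>. At \<open>\<alpha> = 1\<close> the conjugate
  exponent is infinite and \<open>m\<close> has to stay in \<open>{-1..1}\<close>.
\<close>

lemma (in prob_space) mgf_le:
  fixes Y :: "'a \<Rightarrow> real"
  assumes int: "integrable M Y" and mean: "expectation Y = 0"
    and \<alpha>: "\<alpha> \<ge> 1" and exp2: "(\<integral>\<^sup>+\<omega>. ennreal (exp (\<bar>Y \<omega>\<bar> powr \<alpha>)) \<partial>M) \<le> 2"
    and m: "\<alpha> = 1 \<Longrightarrow> \<bar>m\<bar> \<le> 1"
  shows "(\<integral>\<^sup>+\<omega>. ennreal (exp (m * Y \<omega>)) \<partial>M)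
    \<le> ennreal (exp (5 * m\<^sup>2 + (if \<alpha> = 1 then 0 else 2 * \<bar>m\<bar> powr (\<alpha> / (\<alpha> - 1)))))"
proof (cases "\<bar>m\<bar> \<le> 1")
  case True
  then have "(\<integral>\<^sup>+\<omega>. ennreal (exp (m * Y \<omega>)) \<partial>M) \<le> ennreal (exp (5 * m\<^sup>2))"
    by (rule mgf_le_quadratic[OF int mean \<alpha> exp2])
  also have "\<dots> \<le> ennreal (exp (5 * m\<^sup>2 + (if \<alpha> = 1 then 0 else 2 * \<bar>m\<bar> powr (\<alpha> / (\<alpha> - 1)))))"
    by (intro ennreal_leI) auto
  finally show ?thesis .
next
  case False
  with m \<alpha> have "\<alpha> > 1" by force
  then have \<beta>: "0 \<le> \<alpha> / (\<alpha> - 1)" by simp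
  have "1 \<le> \<bar>m\<bar> powr (\<alpha> / (\<alpha> - 1))" using False \<beta> by (intro ge_one_powr_ge_zero) auto
  then have "(2::real) \<le> exp (\<bar>m\<bar> powr (\<alpha> / (\<alpha> - 1)))"
    using exp_ge_add_one_self[of "\<bar>m\<bar> powr (\<alpha> / (\<alpha> - 1))"] by linarith
  then have "2 * exp (\<bar>m\<bar> powr (\<alpha> / (\<alpha> - 1))) \<le> exp (\<bar>m\<bar> powr (\<alpha> / (\<alpha> - 1))) * exp (\<bar>m\<bar> powr (\<alpha> / (\<alpha> - 1)))"
    by (intro mult_right_mono) auto
  also have "\<dots> = exp (2 * \<bar>m\<bar> powr (\<alpha> / (\<alpha> - 1)))" by (simp flip: exp_add)
  also have "\<dots> \<le> exp (5 * m\<^sup>2 + 2 * \<bar>m\<bar> powr (\<alpha> / (\<alpha> - 1)))" by simp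
  finally have le: "2 * exp (\<bar>m\<bar> powr (\<alpha> / (\<alpha> - 1))) \<le> exp (5 * m\<^sup>2 + 2 * \<bar>m\<bar> powr (\<alpha> / (\<alpha> - 1)))" .
  have "(\<integral>\<^sup>+\<omega>. ennreal (exp (m * Y \<omega>)) \<partial>M) \<le> ennreal (2 * exp (\<bar>m\<bar> powr (\<alpha> / (\<alpha> - 1))))"
    using int by (intro mgf_le_conjugate_power \<open>\<alpha> > 1\<close> exp2) auto
  with le \<open>\<alpha> > 1\<close> show ?thesis by (auto intro: order_trans ennreal_leI)
qed

lemma (in prob_space) prob_sum_ge_le_mgf:
  fixes Z :: "'i \<Rightarrow> 'a \<Rightarrow> real"
  assumes fin: "finite I" and indep: "indep_vars (\<lambda>_. borel) Z I" and l: "l > 0"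
    and mgf: "\<And>i. i \<in> I \<Longrightarrow> (\<integral>\<^sup>+\<omega>. ennreal (exp (l * Z i \<omega>)) \<partial>M) \<le> ennreal (exp (\<Gamma> i))"
  shows "prob {\<omega> \<in> space M. x \<le> (\<Sum>i\<in>I. Z i \<omega>)} \<le> exp ((\<Sum>i\<in>I. \<Gamma> i) - l * x)"
proof -
  have [measurable]: "Z i \<in> borel_measurable M" if "i \<in> I" for i
    using indep that unfolding indep_vars_def by auto
  have "ennreal (prob {\<omega> \<in> space M. x \<le> (\<Sum>i\<in>I. Z i \<omega>)})
      = emeasure M {\<omega> \<in> space M. x \<le> (\<Sum>i\<in>I. Z i \<omega>)}"
    by (simp add: emeasure_eq_measure)
  also have "\<dots> \<le> ennreal (exp (- l * x)) * (\<integral>\<^sup>+\<omega>\<in>space M. exp (l * (\<Sum>i\<in>I. Z i \<omega>)) \<partial>M)"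
    by (intro Chernoff_ineq_nn_integral_ge l) auto
  also have "(\<integral>\<^sup>+\<omega>\<in>space M. exp (l * (\<Sum>i\<in>I. Z i \<omega>)) \<partial>M)
      = (\<integral>\<^sup>+\<omega>. (\<Prod>i\<in>I. ennreal (exp (l * Z i \<omega>))) \<partial>M)"
    by (intro nn_integral_cong) (simp add: sum_distrib_left exp_sum fin prod_ennreal)
  also have "\<dots> = (\<Prod>i\<in>I. \<integral>\<^sup>+\<omega>. ennreal (exp (l * Z i \<omega>)) \<partial>M)"
    by (intro indep_vars_nn_integral fin indep_vars_compose2[OF indep]) auto
  also have "ennreal (exp (- l * x)) * \<dots> \<le> ennreal (exp (- l * x)) * (\<Prod>i\<in>I. ennreal (exp (\<Gamma> i)))"
    by (intro mult_left_mono prod_mono_ennreal mgf) auto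
  also have "\<dots> = ennreal (exp ((\<Sum>i\<in>I. \<Gamma> i) - l * x))"
    by (simp add: prod_ennreal exp_sum[OF fin] exp_diff exp_minus divide_inverse mult.commute prod_nonneg
      flip: ennreal_mult)
  finally show ?thesis by simp
qed

lemma (in prob_space) prob_abs_sum_ge_le_mgf:
  fixes Z :: "'i \<Rightarrow> 'a \<Rightarrow> real"
  assumes fin: "finite I" and indep: "indep_vars (\<lambda>_. borel) Z I" and l: "l > 0"
    and mgf: "\<And>i. i \<in> I \<Longrightarrow> (\<integral>\<^sup>+\<omega>. ennreal (exp (l * Z i \<omega>)) \<partial>M) \<le> ennreal (exp (\<Gamma> i))"
    and mgf': "\<And>i. i \<in> I \<Longrightarrow> (\<integral>\<^sup>+\<omega>. ennreal (exp (- l * Z i \<omega>)) \<partial>M) \<le> ennreal (exp (\<Gamma> i))"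
  shows "prob {\<omega> \<in> space M. x \<le> \<bar>\<Sum>i\<in>I. Z i \<omega>\<bar>} \<le> 2 * exp ((\<Sum>i\<in>I. \<Gamma> i) - l * x)"
proof -
  have [measurable]: "Z i \<in> borel_measurable M" if "i \<in> I" for i
    using indep that unfolding indep_vars_def by auto
  have indep': "indep_vars (\<lambda>_. borel) (\<lambda>i \<omega>. - Z i \<omega>) I"
    using indep_vars_compose2[OF indep, of "\<lambda>_ x. - x" "\<lambda>_. borel"] by simp
  have "prob {\<omega> \<in> space M. x \<le> \<bar>\<Sum>i\<in>I. Z i \<omega>\<bar>}
      \<le> prob ({\<omega> \<in> space M. x \<le> (\<Sum>i\<in>I. Z i \<omega>)} \<union> {\<omega> \<in> space M. x \<le> (\<Sum>i\<in>I. - Z i \<omega>)})"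
    by (intro finite_measure_mono) (auto simp: sum_negf)
  also have "\<dots> \<le> prob {\<omega> \<in> space M. x \<le> (\<Sum>i\<in>I. Z i \<omega>)} + prob {\<omega> \<in> space M. x \<le> (\<Sum>i\<in>I. - Z i \<omega>)}"
    by (intro measure_Un_le) measurable
  also have "\<dots> \<le> exp ((\<Sum>i\<in>I. \<Gamma> i) - l * x) + exp ((\<Sum>i\<in>I. \<Gamma> i) - l * x)"
    using mgf mgf' by (intro add_mono prob_sum_ge_le_mgf fin indep indep' l) auto
  finally show ?thesis by simp
qed

text \<open>
  The Chernoff parameter \<open>l\<close> is the largest for which both \<open>(l * N)\<^sup>2 \<le> s\<close> and, when \<open>\<alpha> > 1\<close>,
  \<open>(l * D) powr \<beta> \<le> s\<close>; the log-moment generating function is then at most \<open>5 * s + 2 * s\<close>. Whichever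
  constraint is active, the summand of the threshold that belongs to it contributes \<open>10 * s\<close> to
  \<open>l * x\<close>. For \<open>\<alpha> = 1\<close> the second constraint reads \<open>l * D \<le> 1\<close>, which is what \<open>mgf_le\<close> asks for.
\<close>

lemma (in prob_space) tail_sum_alpha_ge_1:
  fixes Y :: "nat \<Rightarrow> 'a \<Rightarrow> real"
  assumes \<alpha>: "\<alpha> \<ge> 1" and indep: "indep_vars (\<lambda>_. borel) Y {1..n}"
    and int: "\<And>i. i \<in> {1..n} \<Longrightarrow> integrable M (Y i)"
    and mean: "\<And>i. i \<in> {1..n} \<Longrightarrow> expectation (Y i) = 0"
    and exp2: "\<And>i. i \<in> {1..n} \<Longrightarrow> (\<integral>\<^sup>+\<omega>. ennreal (exp (\<bar>Y i \<omega>\<bar> powr \<alpha>)) \<partial>M) \<le> 2"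
    and b: "\<exists>i\<in>{1..n}. b i \<noteq> 0" and s: "s > 0"
    and x: "10 * lr_norm n 2 b * sqrt s + 10 * lr_norm n (beta_exp \<alpha>) b * s powr (1 / \<alpha>) \<le> x"
  shows "prob {\<omega> \<in> space M. x \<le> \<bar>\<Sum>i=1..n. b i * Y i \<omega>\<bar>} \<le> 2 * exp (- 3 * s)"
proof -
  define N where "N = lr_norm n 2 b"
  define D where "D = lr_norm n (beta_exp \<alpha>) b"
  define \<beta> where "\<beta> = \<alpha> / (\<alpha> - 1)"
  have N: "N > 0" and D: "D > 0"
    using lr_norm_2_pos[OF b] lr_norm_beta_exp_pos[OF b] by (auto simp: N_def D_def)
  have N2: "N\<^sup>2 = (\<Sum>i=1..n. (b i)\<^sup>2)"
    unfolding N_def lr_norm_2 by (simp add: sum_nonneg)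
  define l where "l = min (sqrt s / N) (s powr (1 - 1 / \<alpha>) / D)"
  have l: "l > 0" using N D s by (simp add: l_def)
  have lN: "l * N \<le> sqrt s" using N by (simp add: l_def min_def field_simps)
  have lD: "l * D \<le> s powr (1 - 1 / \<alpha>)" using D by (simp add: l_def min_def field_simps)
  define \<Gamma> where "\<Gamma> i = 5 * (l * b i)\<^sup>2 + (if \<alpha> = 1 then 0 else 2 * \<bar>l * b i\<bar> powr \<beta>)" for i
  have "(\<Sum>i=1..n. 5 * (l * b i)\<^sup>2) = 5 * (l * N)\<^sup>2"
    by (simp add: power_mult_distrib N2 sum_distrib_left mult.assoc)
  also have "\<dots> \<le> 5 * (sqrt s)\<^sup>2"
    using lN l N by (intro mult_left_mono power_mono) auto
  finally have quad: "(\<Sum>i=1..n. 5 * (l * b i)\<^sup>2) \<le> 5 * s" using s by simp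
  have conj: "(\<Sum>i=1..n. if \<alpha> = 1 then 0 else 2 * \<bar>l * b i\<bar> powr \<beta>) \<le> 2 * s"
  proof (cases "\<alpha> = 1")
    case False
    then have \<alpha>1: "\<alpha> > 1" and \<beta>: "\<beta> > 0" using \<alpha> by (auto simp: \<beta>_def)
    have "(\<Sum>i=1..n. 2 * \<bar>l * b i\<bar> powr \<beta>) = 2 * (l powr \<beta> * D powr \<beta>)"
      using l unfolding D_def \<beta>_def lr_norm_beta_exp_powr[OF \<alpha>1]
      by (simp add: abs_mult powr_mult sum_distrib_left)
    also have "\<dots> = 2 * (l * D) powr \<beta>" using l D by (simp add: powr_mult)
    also have "\<dots> \<le> 2 * (s powr (1 - 1 / \<alpha>)) powr \<beta>"
      using l D lD \<beta> by (intro mult_left_mono powr_mono2) auto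
    also have "(1 - 1 / \<alpha>) * \<beta> = 1" using \<alpha>1 by (simp add: \<beta>_def field_simps)
    then have "2 * (s powr (1 - 1 / \<alpha>)) powr \<beta> = 2 * s" using s by (simp add: powr_powr)
    finally show ?thesis using False by simp
  qed (use s in simp)
  have \<Gamma>: "(\<Sum>i=1..n. \<Gamma> i) \<le> 7 * s"
    unfolding \<Gamma>_def sum.distrib using quad conj by linarith
  have "10 * s \<le> l * (10 * N * sqrt s + 10 * D * s powr (1 / \<alpha>))"
  proof (cases "sqrt s / N \<le> s powr (1 - 1 / \<alpha>) / D")
    case True
    then have "l * N = sqrt s" using N by (simp add: l_def)
    then have "10 * s = 10 * (l * N * sqrt s)" using s by simp
    also have "\<dots> = l * (10 * N * sqrt s)" by simp
    also have "\<dots> \<le> l * (10 * N * sqrt s + 10 * D * s powr (1 / \<alpha>))"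
      using l D by (intro mult_left_mono) auto
    finally show ?thesis .
  next
    case False
    then have lD_eq: "l * D = s powr (1 - 1 / \<alpha>)" using D by (simp add: l_def)
    have "10 * s = 10 * (s powr (1 - 1 / \<alpha>) * s powr (1 / \<alpha>))"
      using s by (simp flip: powr_add)
    also have "\<dots> = l * (10 * D * s powr (1 / \<alpha>))"
      unfolding lD_eq[symmetric] by simp
    also have "\<dots> \<le> l * (10 * N * sqrt s + 10 * D * s powr (1 / \<alpha>))"
      using l N s by (intro mult_left_mono) auto
    finally show ?thesis .
  qed
  also have "\<dots> \<le> l * x" using x l by (intro mult_left_mono) (auto simp: N_def D_def)
  finally have lx: "10 * s \<le> l * x" .
  have small: "\<bar>l * b i\<bar> \<le> 1" if "i \<in> {1..n}" "\<alpha> = 1" for i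
  proof -
    have "\<bar>l * b i\<bar> = l * \<bar>b i\<bar>" using l by (simp add: abs_mult)
    also have "\<dots> \<le> l * D"
      using l that abs_le_lr_norm_infinity[OF that(1), of b]
      by (intro mult_left_mono) (auto simp: D_def beta_exp_def)
    also have "\<dots> \<le> 1" using lD that(2) s by simp
    finally show ?thesis .
  qed
  have indep': "indep_vars (\<lambda>_. borel) (\<lambda>i \<omega>. b i * Y i \<omega>) {1..n}"
    by (rule indep_vars_compose2[OF indep]) auto
  have "prob {\<omega> \<in> space M. x \<le> \<bar>\<Sum>i=1..n. b i * Y i \<omega>\<bar>} \<le> 2 * exp ((\<Sum>i=1..n. \<Gamma> i) - l * x)"
  proof (rule prob_abs_sum_ge_le_mgf[OF _ indep' l])
    fix i assume i: "i \<in> {1..n}"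
    show "(\<integral>\<^sup>+\<omega>. ennreal (exp (l * (b i * Y i \<omega>))) \<partial>M) \<le> ennreal (exp (\<Gamma> i))"
      using mgf_le[OF int[OF i] mean[OF i] \<alpha> exp2[OF i], of "l * b i", OF small[OF i]]
      unfolding \<Gamma>_def \<beta>_def by (simp add: mult.assoc cong: if_cong split del: if_split)
    show "(\<integral>\<^sup>+\<omega>. ennreal (exp (- l * (b i * Y i \<omega>))) \<partial>M) \<le> ennreal (exp (\<Gamma> i))"
      using mgf_le[OF int[OF i] mean[OF i] \<alpha> exp2[OF i], of "- (l * b i)"] small[OF i]
      unfolding \<Gamma>_def \<beta>_def by (simp add: mult.assoc cong: if_cong split del: if_split)
  qed auto
  also have "\<dots> \<le> 2 * exp (- 3 * s)"
    using \<Gamma> lx by simp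
  finally show ?thesis .
qed

section \<open>Exponents below 1: Moments of Weibull type\<close>

text \<open>
  The maximum of \<open>u powr r * exp (- u)\<close> is attained at \<open>u = r\<close>.
\<close>

lemma powr_le_exp:
  fixes u r :: real
  assumes "u \<ge> 0" "r > 0"
  shows "u powr r \<le> (r / exp 1) powr r * exp u"
proof (cases "u = 0")
  case False
  with assms have u: "u > 0" by simp
  have "ln (u / r) \<le> u / r - 1" using u assms by (intro ln_le_minus_one) simp
  then have "r * ln (u / r) \<le> r * (u / r - 1)" using assms by (intro mult_left_mono) auto
  then have "r * ln u \<le> r * (ln r - 1) + u"
    using u assms by (simp add: ln_div algebra_simps)
  then show ?thesis
    using u assms by (simp add: powr_def ln_div flip: exp_add)
qed (use assms in simp)

text \<open>
  One term of the exponential series at \<open>q\<close>.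
\<close>

lemma power_self_le_exp_fact: "real q ^ q \<le> exp 1 ^ q * fact q"
proof -
  have "(\<Sum>k\<in>{q}. real q ^ k /\<^sub>R fact k) \<le> (\<Sum>k. real q ^ k /\<^sub>R fact k)"
    by (intro sum_le_suminf summable_exp_generic) auto
  then have "real q ^ q / fact q \<le> exp (real q)"
    by (simp add: exp_def divide_inverse mult.commute)
  also have "exp (real q) = exp 1 ^ q" by (simp flip: exp_of_nat_mult)
  finally show ?thesis by (simp add: field_simps)
qed

text \<open>
  Equivalent to \<open>ln x \<le> x / exp 1\<close>, an equality at \<open>x = exp 1\<close>. This is where the constant
  \<open>exp (2 / exp 1)\<close> comes from.
\<close>

lemma square_le_exp:
  assumes "(x::real) > 0" shows "x\<^sup>2 \<le> exp (2 * x / exp 1)"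
proof -
  have "ln (x / exp 1) \<le> x / exp 1 - 1" using assms by (intro ln_le_minus_one) simp
  then have "ln x \<le> x / exp 1" using assms by (simp add: ln_div)
  then have "x \<le> exp (x / exp 1)" using assms by (metis exp_le_cancel_iff exp_ln)
  then have "x\<^sup>2 \<le> (exp (x / exp 1))\<^sup>2" using assms by (intro power_mono) auto
  also have "\<dots> = exp (2 * x / exp 1)" by (simp flip: exp_of_nat_mult)
  finally show ?thesis .
qed

text \<open>
  The scale for which variables with \<open>E exp (\<bar>Y\<bar> powr \<alpha>) \<le> 2\<close> satisfy a Bernstein moment
  condition up to a prescribed order.
\<close>

definition weibull_scale :: "real \<Rightarrow> real" where
  "weibull_scale \<alpha> = exp 1 * (exp (2 / exp 1) / (exp 1 * \<alpha>)) powr (1 / \<alpha>)"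

lemma weibull_scale_pos: "\<alpha> > 0 \<Longrightarrow> weibull_scale \<alpha> > 0"
  by (simp add: weibull_scale_def)

text \<open>
  Put \<open>d = 1 / \<alpha> - 1\<close>. In \<open>q powr (q / \<alpha>) = q ^ q * q powr (2 * d) * q powr ((q - 2) * d)\<close> the first
  factor is a factorial up to \<open>exp 1 ^ q\<close>, the second is exponential in \<open>q\<close> by \<open>square_le_exp\<close>, and in
  the third the base may be enlarged to \<open>p\<close>. Two powers of \<open>q powr d\<close> are kept out of this enlargement,
  so that \<open>p\<close> does not enter the variance term of Bernstein's condition
  \<open>E \<bar>Y\<bar> ^ q \<le> 2 * fact q * v\<^sup>2 * w ^ (q - 2)\<close>.
\<close>

lemma weibull_moment_factorial_bound:
  assumes \<alpha>: "0 < \<alpha>" "\<alpha> \<le> 1" and q: "2 \<le> q" "q \<le> p"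
  shows "(real q / \<alpha> / exp 1) powr (real q / \<alpha>)
    \<le> fact q * weibull_scale \<alpha> ^ q * (real p powr (1 / \<alpha> - 1)) ^ (q - 2)"
proof -
  define d where "d = 1 / \<alpha> - 1"
  have d: "d \<ge> 0" using \<alpha> by (simp add: d_def)
  have q0: "real q > 0" using q by simp
  have "real q powr (real q / \<alpha>) = real q powr (real q + 2 * d + real (q - 2) * d)"
    using q \<alpha> by (intro arg_cong2[of _ _ _ _ "(powr)"]) (auto simp: d_def of_nat_diff field_simps)
  also have "\<dots> = real q ^ q * (real q powr 2) powr d * (real q powr d) ^ (q - 2)"
    using q0 by (simp add: powr_add powr_powr powr_realpow[symmetric] mult.commute del: powr_numeral)
  also have "\<dots> \<le> (exp 1 ^ q * fact q) * exp (2 * real q / exp 1) powr d * (real p powr d) ^ (q - 2)"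
    using q d square_le_exp[OF q0]
    by (intro mult_mono power_self_le_exp_fact powr_mono2 power_mono mult_nonneg_nonneg) auto
  also have "\<dots> \<le> (exp 1 ^ q * fact q) * exp (2 * real q / (exp 1 * \<alpha>)) * (real p powr d) ^ (q - 2)"
  proof -
    have "exp (2 * real q / exp 1) powr d = exp (2 * real q / exp 1 * d)"
      by (simp add: powr_def mult.commute)
    also have "\<dots> \<le> exp (2 * real q / exp 1 * (1 / \<alpha>))"
      by (intro iffD2[OF exp_le_cancel_iff] mult_left_mono) (auto simp: d_def)
    also have "\<dots> = exp (2 * real q / (exp 1 * \<alpha>))" by simp
    finally show ?thesis by (intro mult_right_mono mult_left_mono) auto
  qed
  finally have main: "real q powr (real q / \<alpha>)
      \<le> (exp 1 ^ q * fact q) * exp (2 * real q / (exp 1 * \<alpha>)) * (real p powr d) ^ (q - 2)" .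
  have "weibull_scale \<alpha> ^ q = exp 1 ^ q * (exp (2 / exp 1) / (exp 1 * \<alpha>)) powr (real q / \<alpha>)"
    using \<alpha> by (simp add: weibull_scale_def power_mult_distrib powr_power mult.commute)
  also have "(exp (2 / exp 1) / (exp 1 * \<alpha>)) powr (real q / \<alpha>)
      = exp (2 * real q / (exp 1 * \<alpha>)) / (exp 1 * \<alpha>) powr (real q / \<alpha>)"
    using \<alpha> by (simp add: powr_divide) (simp add: powr_def field_simps)
  finally have A: "weibull_scale \<alpha> ^ q
      = exp 1 ^ q * (exp (2 * real q / (exp 1 * \<alpha>)) / (exp 1 * \<alpha>) powr (real q / \<alpha>))" .
  have "(real q / \<alpha> / exp 1) powr (real q / \<alpha>)
      = real q powr (real q / \<alpha>) / (exp 1 * \<alpha>) powr (real q / \<alpha>)"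
    using \<alpha> q0 by (simp add: powr_divide powr_mult)
  also have "\<dots> \<le> (exp 1 ^ q * fact q) * exp (2 * real q / (exp 1 * \<alpha>)) * (real p powr d) ^ (q - 2)
      / (exp 1 * \<alpha>) powr (real q / \<alpha>)"
    by (intro divide_right_mono main) auto
  also have "\<dots> = fact q * weibull_scale \<alpha> ^ q * (real p powr d) ^ (q - 2)"
    unfolding A by simp
  finally show ?thesis by (simp add: d_def)
qed

text \<open>
  The pointwise bound \<open>powr_le_exp\<close> at \<open>u = \<bar>Y\<bar> powr \<alpha>\<close> and \<open>r = q / \<alpha>\<close>.
\<close>

lemma (in prob_space) weibull_moments:
  fixes Y :: "'a \<Rightarrow> real"
  assumes [measurable]: "Y \<in> borel_measurable M" and \<alpha>: "\<alpha> > 0"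
    and exp2: "(\<integral>\<^sup>+\<omega>. ennreal (exp (\<bar>Y \<omega>\<bar> powr \<alpha>)) \<partial>M) \<le> 2" and q: "q > 0"
  shows weibull_moment_integrable: "integrable M (\<lambda>\<omega>. \<bar>Y \<omega>\<bar> ^ q)"
    and weibull_moment_le:
      "expectation (\<lambda>\<omega>. \<bar>Y \<omega>\<bar> ^ q) \<le> 2 * (real q / \<alpha> / exp 1) powr (real q / \<alpha>)"
proof -
  define c where "c = (real q / \<alpha> / exp 1) powr (real q / \<alpha>)"
  have "(\<integral>\<^sup>+\<omega>. ennreal (\<bar>Y \<omega>\<bar> ^ q) \<partial>M) \<le> (\<integral>\<^sup>+\<omega>. ennreal c * ennreal (exp (\<bar>Y \<omega>\<bar> powr \<alpha>)) \<partial>M)"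
  proof (rule nn_integral_mono)
    fix \<omega>
    have "\<bar>Y \<omega>\<bar> ^ q = (\<bar>Y \<omega>\<bar> powr \<alpha>) powr (real q / \<alpha>)"
      using \<alpha> q by (simp add: powr_powr powr_realpow')
    also have "\<dots> \<le> c * exp (\<bar>Y \<omega>\<bar> powr \<alpha>)"
      unfolding c_def using \<alpha> q by (intro powr_le_exp) auto
    finally show "ennreal (\<bar>Y \<omega>\<bar> ^ q) \<le> ennreal c * ennreal (exp (\<bar>Y \<omega>\<bar> powr \<alpha>))"
      by (simp add: c_def ennreal_leI flip: ennreal_mult)
  qed
  also have "\<dots> = ennreal c * (\<integral>\<^sup>+\<omega>. ennreal (exp (\<bar>Y \<omega>\<bar> powr \<alpha>)) \<partial>M)"
    by (rule nn_integral_cmult) measurable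
  also have "\<dots> \<le> ennreal c * 2" by (intro mult_left_mono exp2) auto
  also have "\<dots> = ennreal (2 * c)" by (simp add: c_def ennreal_mult mult.commute)
  finally have le: "(\<integral>\<^sup>+\<omega>. ennreal (\<bar>Y \<omega>\<bar> ^ q) \<partial>M) \<le> ennreal (2 * c)" .
  show int: "integrable M (\<lambda>\<omega>. \<bar>Y \<omega>\<bar> ^ q)"
    using le by (intro integrableI_nonneg) (auto intro: le_less_trans)
  show "expectation (\<lambda>\<omega>. \<bar>Y \<omega>\<bar> ^ q) \<le> 2 * c"
    using le by (subst (asm) nn_integral_eq_integral[OF int]) (auto simp: c_def)
qed

section \<open>Exponents below 1: Truncated moment series of independent sums\<close>

text \<open>
  Truncating the exponential series at the order \<open>p\<close> makes it finite for variables without exponential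
  moments. The moments enter with absolute values outside the integral, so that centring still
  removes the linear term.
\<close>

definition moment_series :: "'w measure \<Rightarrow> nat \<Rightarrow> real \<Rightarrow> ('w \<Rightarrow> real) \<Rightarrow> real" where
  "moment_series M p l X = (\<Sum>q\<le>p. l ^ q * \<bar>\<integral>\<omega>. X \<omega> ^ q \<partial>M\<bar> / fact q)"

lemma sum_convolution_le:
  fixes u v :: "nat \<Rightarrow> real"
  assumes "\<And>i. u i \<ge> 0" "\<And>i. v i \<ge> 0"
  shows "(\<Sum>q\<le>p. \<Sum>r\<le>q. u r * v (q - r)) \<le> (\<Sum>i\<le>p. u i) * (\<Sum>j\<le>p. v j)"
proof -
  have "(\<Sum>q\<le>p. \<Sum>r\<le>q. u r * v (q - r)) = (\<Sum>(i, j)\<in>{(i, j). i + j \<le> p}. u i * v j)"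
    by (rule sum.triangle_reindex_eq[symmetric])
  also have "\<dots> \<le> (\<Sum>(i, j)\<in>{..p} \<times> {..p}. u i * v j)"
    using assms by (intro sum_mono2) auto
  also have "\<dots> = (\<Sum>i\<le>p. u i) * (\<Sum>j\<le>p. v j)"
    by (simp add: sum_product sum.cartesian_product)
  finally show ?thesis .
qed

text \<open>
  The binomial theorem and independence say that the normalised moments of order up to \<open>p\<close> of a sum are
  the convolution of those of the summands; in the product of the two series further nonnegative terms
  appear.
\<close>

lemma (in prob_space) moments_of_independent_sum:
  fixes Z S :: "'a \<Rightarrow> real"
  assumes indep: "indep_var borel Z borel S" and l: "l \<ge> 0"
    and Z: "\<And>q. integrable M (\<lambda>\<omega>. Z \<omega> ^ q)" and S: "\<And>q. integrable M (\<lambda>\<omega>. S \<omega> ^ q)"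
  shows moments_integrable_add: "integrable M (\<lambda>\<omega>. (Z \<omega> + S \<omega>) ^ q)"
    and moment_series_add_le:
      "moment_series M p l (\<lambda>\<omega>. Z \<omega> + S \<omega>) \<le> moment_series M p l Z * moment_series M p l S"
proof -
  have ind: "indep_var borel (\<lambda>\<omega>. Z \<omega> ^ i) borel (\<lambda>\<omega>. S \<omega> ^ j)" for i j :: nat
    using indep_var_compose[OF indep, of "\<lambda>x. x ^ i" borel "\<lambda>x. x ^ j" borel] by (simp add: comp_def)
  have int: "integrable M (\<lambda>\<omega>. Z \<omega> ^ i * S \<omega> ^ j)" for i j
    by (rule indep_var_integrable[OF ind Z S])
  have E: "expectation (\<lambda>\<omega>. Z \<omega> ^ i * S \<omega> ^ j)
      = expectation (\<lambda>\<omega>. Z \<omega> ^ i) * expectation (\<lambda>\<omega>. S \<omega> ^ j)" for i j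
    by (rule indep_var_lebesgue_integral[OF ind Z S])
  have int': "integrable M (\<lambda>\<omega>. real (q choose r) * Z \<omega> ^ r * S \<omega> ^ (q - r))" for q r
    using int by (simp add: mult.assoc)
  show "integrable M (\<lambda>\<omega>. (Z \<omega> + S \<omega>) ^ q)" for q
    unfolding binomial_ring using int' by auto
  define z where "z i = expectation (\<lambda>\<omega>. Z \<omega> ^ i)" for i :: nat
  define t where "t i = expectation (\<lambda>\<omega>. S \<omega> ^ i)" for i :: nat
  have term_le: "l ^ q * \<bar>expectation (\<lambda>\<omega>. (Z \<omega> + S \<omega>) ^ q)\<bar> / fact q
      \<le> (\<Sum>r\<le>q. (l ^ r * \<bar>z r\<bar> / fact r) * (l ^ (q - r) * \<bar>t (q - r)\<bar> / fact (q - r)))" for q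
  proof -
    have "expectation (\<lambda>\<omega>. (Z \<omega> + S \<omega>) ^ q) = (\<Sum>r\<le>q. real (q choose r) * (z r * t (q - r)))"
      unfolding binomial_ring using int'
      by (simp add: Bochner_Integration.integral_sum mult.assoc E z_def t_def)
    then have "\<bar>expectation (\<lambda>\<omega>. (Z \<omega> + S \<omega>) ^ q)\<bar> \<le> (\<Sum>r\<le>q. real (q choose r) * (\<bar>z r\<bar> * \<bar>t (q - r)\<bar>))"
      by (auto intro!: order_trans[OF sum_abs] sum_mono simp: abs_mult)
    then have "l ^ q * \<bar>expectation (\<lambda>\<omega>. (Z \<omega> + S \<omega>) ^ q)\<bar> / fact q
        \<le> l ^ q * (\<Sum>r\<le>q. real (q choose r) * (\<bar>z r\<bar> * \<bar>t (q - r)\<bar>)) / fact q"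
      using l by (intro divide_right_mono mult_left_mono) auto
    also have "\<dots> = (\<Sum>r\<le>q. (l ^ r * \<bar>z r\<bar> / fact r) * (l ^ (q - r) * \<bar>t (q - r)\<bar> / fact (q - r)))"
      unfolding sum_distrib_left sum_divide_distrib
    proof (rule sum.cong)
      fix r assume "r \<in> {..q}"
      then have r: "r \<le> q" by simp
      have "l ^ q = l ^ r * l ^ (q - r)" using r by (simp flip: power_add)
      then show "l ^ q * (real (q choose r) * (\<bar>z r\<bar> * \<bar>t (q - r)\<bar>)) / fact q
          = (l ^ r * \<bar>z r\<bar> / fact r) * (l ^ (q - r) * \<bar>t (q - r)\<bar> / fact (q - r))"
        by (simp add: binomial_fact[OF r])
    qed simp
    finally show ?thesis .
  qed
  have "moment_series M p l (\<lambda>\<omega>. Z \<omega> + S \<omega>)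
      \<le> (\<Sum>q\<le>p. \<Sum>r\<le>q. (l ^ r * \<bar>z r\<bar> / fact r) * (l ^ (q - r) * \<bar>t (q - r)\<bar> / fact (q - r)))"
    unfolding moment_series_def by (intro sum_mono term_le)
  also have "\<dots> \<le> moment_series M p l Z * moment_series M p l S"
    unfolding moment_series_def z_def[symmetric] t_def[symmetric]
    using l by (intro sum_convolution_le) auto
  finally show "moment_series M p l (\<lambda>\<omega>. Z \<omega> + S \<omega>) \<le> moment_series M p l Z * moment_series M p l S" .
qed

lemma moment_series_nonneg: "l \<ge> 0 \<Longrightarrow> moment_series M p l X \<ge> 0"
  by (auto simp: moment_series_def intro!: sum_nonneg)

text \<open>
  Integrability and the estimate are proved together, since splitting off a summand requires that the remaining
  sum has all moments.
\<close>

lemma (in prob_space) moment_series_sum_le: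
  fixes Z :: "'i \<Rightarrow> 'a \<Rightarrow> real"
  assumes "finite I" "indep_vars (\<lambda>_. borel) Z I" and l: "l \<ge> 0"
    and "\<And>i q. i \<in> I \<Longrightarrow> integrable M (\<lambda>\<omega>. Z i \<omega> ^ q)"
  shows "(\<forall>q. integrable M (\<lambda>\<omega>. (\<Sum>i\<in>I. Z i \<omega>) ^ q))
    \<and> moment_series M p l (\<lambda>\<omega>. \<Sum>i\<in>I. Z i \<omega>) \<le> (\<Prod>i\<in>I. moment_series M p l (Z i))"
  using assms(1,2,4)
proof (induction I rule: finite_induct)
  case empty
  have "moment_series M p l (\<lambda>_. 0) = (\<Sum>q\<le>p. if q = 0 then 1 else 0)"
    unfolding moment_series_def by (intro sum.cong) (auto simp: power_0_left prob_space)
  then show ?case by (simp add: sum.delta)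
next
  case (insert i I)
  have ind: "indep_vars (\<lambda>_. borel) Z I"
    using insert.prems(1) by (rule indep_vars_subset) auto
  note IH = insert.IH[OF ind insert.prems(2)[OF insertI2]]
  have iv: "indep_var borel (Z i) borel (\<lambda>\<omega>. \<Sum>j\<in>I. Z j \<omega>)"
    by (rule indep_vars_sum[OF insert.hyps insert.prems(1)])
  note add = moments_of_independent_sum[OF iv l insert.prems(2)[OF insertI1] IH[THEN conjunct1, rule_format]]
  have "moment_series M p l (\<lambda>\<omega>. Z i \<omega> + (\<Sum>j\<in>I. Z j \<omega>))
      \<le> moment_series M p l (Z i) * (\<Prod>j\<in>I. moment_series M p l (Z j))"
    using IH l by (intro order_trans[OF add(2)] mult_left_mono moment_series_nonneg) auto
  with add(1) insert.hyps show ?case by simp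
qed

lemma sum_half_powers_from_2:
  "(\<Sum>q\<le>p. if q < 2 then 0 else (1/2::real) ^ (q - 2)) \<le> 2"
proof -
  have "(\<Sum>q\<le>p. if q < 2 then 0 else (1/2::real) ^ (q - 2)) \<le> 2 - 4 * inverse (2 ^ p)" if "p \<ge> 1"
    using that
  proof (induction p rule: dec_induct)
    case (step p)
    then obtain k where "p = Suc k" by (cases p) auto
    with step.IH show ?case by (simp add: power_one_over inverse_eq_divide)
  qed simp
  moreover have "0 \<le> 4 * inverse ((2::real) ^ p)" by simp
  ultimately show ?thesis by (cases "p \<ge> 1") (linarith, simp)
qed

text \<open>
  Under Bernstein's moment condition the terms of order at least 2 are dominated by a geometric series
  of ratio \<open>l * w \<le> 1 / 2\<close> that starts at \<open>2 * (l * v)\<^sup>2\<close>.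
\<close>

lemma (in prob_space) moment_series_le:
  fixes Z :: "'a \<Rightarrow> real"
  assumes mean: "expectation Z = 0" and l: "l \<ge> 0" and w: "w \<ge> 0" "l * w \<le> 1 / 2"
    and moments: "\<And>q. 2 \<le> q \<Longrightarrow> q \<le> p \<Longrightarrow> expectation (\<lambda>\<omega>. \<bar>Z \<omega>\<bar> ^ q) \<le> 2 * fact q * v\<^sup>2 * w ^ (q - 2)"
  shows "moment_series M p l Z \<le> exp (4 * (l * v)\<^sup>2)"
proof -
  have "moment_series M p l Z
      \<le> (\<Sum>q\<le>p. (if q = 0 then 1 else 0) + 2 * (l * v)\<^sup>2 * (if q < 2 then 0 else (1/2) ^ (q - 2)))"
    unfolding moment_series_def
  proof (rule sum_mono)
    fix q assume "q \<in> {..p}"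
    then have qp: "q \<le> p" by simp
    consider "q = 0" | "q = 1" | "q \<ge> 2" by linarith
    then show "l ^ q * \<bar>expectation (\<lambda>\<omega>. Z \<omega> ^ q)\<bar> / fact q
        \<le> (if q = 0 then 1 else 0) + 2 * (l * v)\<^sup>2 * (if q < 2 then 0 else (1/2) ^ (q - 2))"
    proof cases
      case 3
      have "\<bar>expectation (\<lambda>\<omega>. Z \<omega> ^ q)\<bar> \<le> expectation (\<lambda>\<omega>. \<bar>Z \<omega>\<bar> ^ q)"
        using integral_abs_bound[of M "\<lambda>\<omega>. Z \<omega> ^ q"] by (simp add: power_abs)
      also have "\<dots> \<le> 2 * fact q * v\<^sup>2 * w ^ (q - 2)" by (rule moments[OF 3 qp])
      finally have "l ^ q * \<bar>expectation (\<lambda>\<omega>. Z \<omega> ^ q)\<bar> / fact q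
          \<le> l ^ q * (2 * fact q * v\<^sup>2 * w ^ (q - 2)) / fact q"
        using l by (intro divide_right_mono mult_left_mono) auto
      also have "\<dots> = 2 * (l * v)\<^sup>2 * (l * w) ^ (q - 2)"
      proof -
        have lq: "l ^ q = l\<^sup>2 * l ^ (q - 2)" using 3 by (simp only: power_add[symmetric] le_add_diff_inverse)
        show ?thesis unfolding lq power_mult_distrib by simp
      qed
      also have "\<dots> \<le> 2 * (l * v)\<^sup>2 * (1/2) ^ (q - 2)"
        using l w by (intro mult_left_mono power_mono) auto
      finally show ?thesis using 3 by simp
    qed (use mean in \<open>auto simp: prob_space\<close>)
  qed
  also have "\<dots> = 1 + 2 * (l * v)\<^sup>2 * (\<Sum>q\<le>p. if q < 2 then 0 else (1/2) ^ (q - 2))"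
    by (simp add: sum.distrib sum_distrib_left sum.delta)
  also have "\<dots> \<le> 1 + 2 * (l * v)\<^sup>2 * 2"
    by (intro add_left_mono mult_left_mono sum_half_powers_from_2) auto
  also have "\<dots> \<le> exp (4 * (l * v)\<^sup>2)"
    using exp_ge_add_one_self[of "4 * (l * v)\<^sup>2"] by simp
  finally show ?thesis .
qed

text \<open>
  The order \<open>p\<close> term of the series gives \<open>E S ^ p \<le> fact p * exp p / l ^ p\<close>. With \<open>fact p \<le> p ^ p\<close>
  and Markov's inequality the probability is at most \<open>(p * exp 1 / (l * x)) ^ p\<close>.
\<close>

lemma (in prob_space) prob_abs_ge_le_moment_series:
  fixes S :: "'a \<Rightarrow> real"
  assumes int: "integrable M (\<lambda>\<omega>. S \<omega> ^ p)" and p: "even p" "p > 0" and l: "l > 0"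
    and series: "moment_series M p l S \<le> exp (real p)" and x: "real p * exp 2 \<le> l * x"
  shows "prob {\<omega> \<in> space M. x \<le> \<bar>S \<omega>\<bar>} \<le> exp (- real p)"
proof -
  have "0 < real p * exp 2" using p by simp
  with x have "0 < l * x" by linarith
  then have x0: "x > 0" using l by (simp add: zero_less_mult_iff)
  have pos: "0 \<le> S \<omega> ^ p" for \<omega> using p by (simp add: zero_le_even_power)
  have "l ^ p * \<bar>expectation (\<lambda>\<omega>. S \<omega> ^ p)\<bar> / fact p \<le> moment_series M p l S"
    unfolding moment_series_def using l
    by (intro member_le_sum[of p "{..p}" "\<lambda>q. l ^ q * \<bar>expectation (\<lambda>\<omega>. S \<omega> ^ q)\<bar> / fact q"]) auto
  moreover have "l ^ p * expectation (\<lambda>\<omega>. S \<omega> ^ p) / fact p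
      \<le> l ^ p * \<bar>expectation (\<lambda>\<omega>. S \<omega> ^ p)\<bar> / fact p"
    using l by (intro divide_right_mono mult_left_mono) auto
  ultimately have "l ^ p * expectation (\<lambda>\<omega>. S \<omega> ^ p) / fact p \<le> exp (real p)" using series by linarith
  then have E: "expectation (\<lambda>\<omega>. S \<omega> ^ p) \<le> fact p * exp (real p) / l ^ p"
    using l by (simp add: field_simps)
  have "x ^ p \<le> S \<omega> ^ p" if "x \<le> \<bar>S \<omega>\<bar>" for \<omega>
    using power_mono[OF that, of p] x0 p by (simp add: power_even_abs)
  then have "{\<omega> \<in> space M. x \<le> \<bar>S \<omega>\<bar>} \<subseteq> {\<omega> \<in> space M. x ^ p \<le> S \<omega> ^ p}" by auto
  then have "prob {\<omega> \<in> space M. x \<le> \<bar>S \<omega>\<bar>} \<le> prob {\<omega> \<in> space M. x ^ p \<le> S \<omega> ^ p}"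
    using int by (intro finite_measure_mono) auto
  also have "\<dots> \<le> expectation (\<lambda>\<omega>. S \<omega> ^ p) / x ^ p"
    using x0 pos by (intro integral_Markov_inequality_measure[where A = "space M"] int) auto
  also have "\<dots> \<le> fact p * exp (real p) / l ^ p / x ^ p"
    using x0 by (intro divide_right_mono E) auto
  also have "\<dots> = fact p * exp (real p) / (l * x) ^ p" by (simp add: power_mult_distrib)
  also have "\<dots> \<le> real p ^ p * exp (real p) / (real p * exp 2) ^ p"
    using x p fact_le_power[of p] \<open>0 < l * x\<close>
    by (intro frac_le mult_right_mono power_mono) auto
  also have "\<dots> = exp (real p) / exp 2 ^ p" using p by (simp add: power_mult_distrib)
  also have "\<dots> = exp (- real p)"
    by (simp flip: exp_of_nat_mult exp_diff)
  finally show ?thesis .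
qed

text \<open>
  An even number between \<open>3 * s\<close> and \<open>3 * s + 2\<close>; the lower bound on \<open>s\<close> absorbs the 2.
\<close>

lemma ex_even_nat_near:
  assumes "s \<ge> (2::real) / 9"
  shows "\<exists>p::nat. even p \<and> p > 0 \<and> 3 * s \<le> real p \<and> real p \<le> 16 * s"
proof (intro exI conjI)
  let ?p = "2 * nat \<lceil>3 * s / 2\<rceil>"
  have "0 < \<lceil>3 * s / 2\<rceil>" using assms by simp
  then show "?p > 0" by simp
  have "real ?p = 2 * of_int \<lceil>3 * s / 2\<rceil>" using \<open>0 < \<lceil>3 * s / 2\<rceil>\<close> by simp
  then show "3 * s \<le> real ?p" "real ?p \<le> 16 * s"
    using le_of_int_ceiling[of "3 * s / 2"] of_int_ceiling_le_add_one[of "3 * s / 2"] assms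
    by linarith+
qed simp

text \<open>
  For \<open>s < 2 / 9\<close> the right-hand side exceeds 1, because \<open>2 / 3 \<le> ln 2\<close>. Otherwise take an even \<open>p\<close>
  with \<open>3 * s \<le> p \<le> 16 * s\<close> and the largest \<open>l\<close> that satisfies \<open>l * (A * P * B) \<le> 1 / 2\<close>, which
  \<open>moment_series_le\<close> needs, and \<open>4 * (l * A * N)\<^sup>2 \<le> p\<close>, which bounds the moment series of the sum
  by \<open>exp p\<close>; here \<open>A\<close> is the scale of Bernstein's condition, \<open>P = p powr (1 / \<alpha> - 1)\<close>, and \<open>N\<close>
  and \<open>B\<close> are the Euclidean and the maximum norm of \<open>b\<close>. The two constraints on \<open>l\<close> correspond to
  the two summands of the threshold, and whichever is active, its summand contributes at least
  \<open>p * exp 2\<close> to \<open>l * x\<close>.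
\<close>

lemma (in prob_space) tail_sum_alpha_less_1:
  fixes Y :: "nat \<Rightarrow> 'a \<Rightarrow> real"
  assumes \<alpha>: "0 < \<alpha>" "\<alpha> < 1" and indep: "indep_vars (\<lambda>_. borel) Y {1..n}"
    and mean: "\<And>i. i \<in> {1..n} \<Longrightarrow> expectation (Y i) = 0"
    and exp2: "\<And>i. i \<in> {1..n} \<Longrightarrow> (\<integral>\<^sup>+\<omega>. ennreal (exp (\<bar>Y i \<omega>\<bar> powr \<alpha>)) \<partial>M) \<le> 2"
    and b: "\<exists>i\<in>{1..n}. b i \<noteq> 0" and s: "s > 0"
    and x: "8 * exp 2 * weibull_scale \<alpha> * lr_norm n 2 b * sqrt s
      + 2 * exp 2 * 16 powr (1 / \<alpha>) * weibull_scale \<alpha> * lr_norm n \<infinity> b * s powr (1 / \<alpha>) \<le> x"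
  shows "prob {\<omega> \<in> space M. x \<le> \<bar>\<Sum>i=1..n. b i * Y i \<omega>\<bar>} \<le> 2 * exp (- 3 * s)"
proof (cases "s < 2 / 9")
  case True
  then have "3 * s \<le> ln 2" using ln2_ge_two_thirds by simp
  then have "exp (3 * s) \<le> 2" by (metis exp_le_cancel_iff exp_ln zero_less_numeral)
  then have "1 \<le> 2 * exp (- 3 * s)" by (simp add: exp_minus field_simps)
  then show ?thesis using prob_le_1 order_trans by blast
next
  case False
  then obtain p :: nat where p: "even p" "p > 0" "3 * s \<le> real p" "real p \<le> 16 * s"
    using ex_even_nat_near[of s] by auto
  define N where "N = lr_norm n 2 b"
  define B where "B = lr_norm n \<infinity> b"
  define A where "A = weibull_scale \<alpha>"
  define P where "P = real p powr (1 / \<alpha> - 1)"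
  have N: "N > 0" and B: "B > 0"
    using lr_norm_2_pos[OF b] lr_norm_beta_exp_pos[OF b, of 1] by (auto simp: N_def B_def beta_exp_def)
  have bB: "\<bar>b i\<bar> \<le> B" if "i \<in> {1..n}" for i
    using abs_le_lr_norm_infinity[OF that] by (simp add: B_def)
  have A: "A > 0" using \<alpha> by (simp add: A_def weibull_scale_pos)
  have P: "P > 0" using p by (simp add: P_def)
  have N2: "N\<^sup>2 = (\<Sum>i=1..n. (b i)\<^sup>2)"
    unfolding N_def lr_norm_2 by (simp add: sum_nonneg)
  define l where "l = min (sqrt p / (2 * A * N)) (1 / (2 * A * P * B))"
  have l: "l > 0" using N A B P p by (simp add: l_def)
  have lN: "2 * (l * A * N) \<le> sqrt p"
  proof -
    have "l \<le> sqrt p / (2 * A * N)" by (simp add: l_def)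
    then show ?thesis using A N by (simp add: pos_le_divide_eq mult_ac)
  qed
  have lB: "l * (A * P * B) \<le> 1 / 2"
  proof -
    have "l \<le> 1 / (2 * A * P * B)" by (simp add: l_def)
    then show ?thesis using A P B by (simp add: pos_le_divide_eq mult_ac)
  qed
  have [measurable]: "Y i \<in> borel_measurable M" if "i \<in> {1..n}" for i
    using indep that unfolding indep_vars_def by auto
  define Z where "Z i \<omega> = b i * Y i \<omega>" for i \<omega>
  have indepZ: "indep_vars (\<lambda>_. borel) Z {1..n}"
    unfolding Z_def by (rule indep_vars_compose2[OF indep]) auto
  have intY: "integrable M (\<lambda>\<omega>. \<bar>Y i \<omega>\<bar> ^ q)" if "i \<in> {1..n}" for i q
    using weibull_moment_integrable[OF _ \<alpha>(1) exp2[OF that], of q] that by (cases "q = 0") auto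
  have intZ: "integrable M (\<lambda>\<omega>. Z i \<omega> ^ q)" if i: "i \<in> {1..n}" for i q
  proof -
    have "integrable M (\<lambda>\<omega>. Y i \<omega> ^ q)"
      using intY[OF i, of q] i by (subst integrable_norm_iff[symmetric]) (auto simp: power_abs)
    then show ?thesis by (simp add: Z_def power_mult_distrib)
  qed
  have series_i: "moment_series M p l (Z i) \<le> exp (4 * (l * (A * b i))\<^sup>2)" if i: "i \<in> {1..n}" for i
  proof (rule moment_series_le[OF _ _ _ lB])
    show "expectation (Z i) = 0" using mean[OF i] by (simp add: Z_def[abs_def])
    fix q assume q: "2 \<le> q" "q \<le> p"
    have "expectation (\<lambda>\<omega>. \<bar>Z i \<omega>\<bar> ^ q) = \<bar>b i\<bar> ^ q * expectation (\<lambda>\<omega>. \<bar>Y i \<omega>\<bar> ^ q)"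
      by (simp add: Z_def abs_mult power_mult_distrib)
    also have "\<dots> \<le> \<bar>b i\<bar> ^ q * (2 * (real q / \<alpha> / exp 1) powr (real q / \<alpha>))"
      using weibull_moment_le[OF _ \<alpha>(1) exp2[OF i], of q] i q by (intro mult_left_mono) auto
    also have "\<dots> \<le> \<bar>b i\<bar> ^ q * (2 * (fact q * A ^ q * P ^ (q - 2)))"
      using weibull_moment_factorial_bound[OF \<alpha>(1) _ q] \<alpha>
      by (intro mult_left_mono) (auto simp: A_def P_def)
    also have "\<dots> = 2 * fact q * (\<bar>b i\<bar> * A) ^ q * P ^ (q - 2)" by (simp add: power_mult_distrib)
    also have "(\<bar>b i\<bar> * A) ^ q = (\<bar>b i\<bar> * A)\<^sup>2 * (\<bar>b i\<bar> * A) ^ (q - 2)"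
      using q by (simp only: power_add[symmetric] le_add_diff_inverse)
    also have "2 * fact q * ((\<bar>b i\<bar> * A)\<^sup>2 * (\<bar>b i\<bar> * A) ^ (q - 2)) * P ^ (q - 2)
        \<le> 2 * fact q * ((\<bar>b i\<bar> * A)\<^sup>2 * (B * A) ^ (q - 2)) * P ^ (q - 2)"
      using bB[OF i] A P by (intro mult_right_mono mult_left_mono power_mono) auto
    also have "\<dots> = 2 * fact q * (A * b i)\<^sup>2 * (A * P * B) ^ (q - 2)"
      by (simp add: power_mult_distrib mult_ac)
    finally show "expectation (\<lambda>\<omega>. \<bar>Z i \<omega>\<bar> ^ q) \<le> 2 * fact q * (A * b i)\<^sup>2 * (A * P * B) ^ (q - 2)" .
  qed (use l A P B in auto)
  \<comment> \<open>Independence enters here: the exponents \<open>4 * (l * A * b i)\<^sup>2\<close> add up to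
    \<open>(2 * l * A * N)\<^sup>2 \<le> p\<close>.\<close>
  note sum = moment_series_sum_le[OF finite_atLeastAtMost indepZ less_imp_le[OF l] intZ, of p]
  have "moment_series M p l (\<lambda>\<omega>. \<Sum>i=1..n. Z i \<omega>) \<le> (\<Prod>i=1..n. moment_series M p l (Z i))"
    using sum by blast
  also have "\<dots> \<le> (\<Prod>i=1..n. exp (4 * (l * (A * b i))\<^sup>2))"
    using l by (intro prod_mono conjI series_i moment_series_nonneg) auto
  also have "\<dots> = exp ((2 * (l * A * N))\<^sup>2)"
    by (simp add: power_mult_distrib N2 sum_distrib_left mult_ac flip: exp_sum)
  also have "\<dots> \<le> exp ((sqrt p)\<^sup>2)"
    using lN l A N by (intro iffD2[OF exp_le_cancel_iff] power_mono) auto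
  finally have series: "moment_series M p l (\<lambda>\<omega>. \<Sum>i=1..n. Z i \<omega>) \<le> exp (real p)" by simp
  have "real p * exp 2 \<le> l * (8 * exp 2 * A * N * sqrt s
      + 2 * exp 2 * 16 powr (1 / \<alpha>) * A * B * s powr (1 / \<alpha>))"
  proof (cases "sqrt p / (2 * A * N) \<le> 1 / (2 * A * P * B)")
    case True
    then have lAN: "l * (A * N) = sqrt p / 2" using A N by (simp add: l_def)
    have "sqrt p \<le> sqrt (16 * s)" using p by simp
    then have "sqrt p \<le> 4 * sqrt s" by (simp add: real_sqrt_mult)
    then have "sqrt p * sqrt p \<le> sqrt p * (4 * sqrt s)" by (intro mult_left_mono) auto
    then have "real p * exp 2 \<le> sqrt p * (4 * sqrt s) * exp 2" by (intro mult_right_mono) auto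
    also have "\<dots> = 8 * exp 2 * (sqrt p / 2) * sqrt s" by simp
    also have "\<dots> = l * (8 * exp 2 * A * N * sqrt s)" unfolding lAN[symmetric] by simp
    also have "\<dots> \<le> l * (8 * exp 2 * A * N * sqrt s
        + 2 * exp 2 * 16 powr (1 / \<alpha>) * A * B * s powr (1 / \<alpha>))"
      using l A B by (intro mult_left_mono) auto
    finally show ?thesis .
  next
    case False
    then have lAB: "l * (A * B) = 1 / (2 * P)" using A B P by (simp add: l_def field_simps)
    \<comment> \<open>\<open>P\<close> is the factor frozen at the order \<open>p\<close>; \<open>p * P = p powr (1 / \<alpha>)\<close> is the source of
      the growth \<open>s powr (1 / \<alpha>)\<close>.\<close>
    have "real p * P = real p powr 1 * real p powr (1 / \<alpha> - 1)" using p by (simp add: P_def)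
    also have "\<dots> = real p powr (1 / \<alpha>)" by (simp only: powr_add[symmetric]) simp
    also have "\<dots> \<le> (16 * s) powr (1 / \<alpha>)" using p \<alpha> by (intro powr_mono2) auto
    also have "\<dots> = 16 powr (1 / \<alpha>) * s powr (1 / \<alpha>)" using s by (simp add: powr_mult)
    finally have "real p \<le> 16 powr (1 / \<alpha>) * s powr (1 / \<alpha>) / P" using P by (simp add: pos_le_divide_eq)
    then have "real p * exp 2 \<le> 16 powr (1 / \<alpha>) * s powr (1 / \<alpha>) / P * exp 2"
      by (intro mult_right_mono) auto
    also have "\<dots> = 2 * exp 2 * 16 powr (1 / \<alpha>) * (1 / (2 * P)) * s powr (1 / \<alpha>)" by simp
    also have "\<dots> = l * (2 * exp 2 * 16 powr (1 / \<alpha>) * A * B * s powr (1 / \<alpha>))"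
      unfolding lAB[symmetric] by simp
    also have "\<dots> \<le> l * (8 * exp 2 * A * N * sqrt s
        + 2 * exp 2 * 16 powr (1 / \<alpha>) * A * B * s powr (1 / \<alpha>))"
      using l A N s by (intro mult_left_mono) auto
    finally show ?thesis .
  qed
  also have "\<dots> \<le> l * x"
    using x l by (intro mult_left_mono) (auto simp: A_def N_def B_def)
  finally have lx: "real p * exp 2 \<le> l * x" .
  have "prob {\<omega> \<in> space M. x \<le> \<bar>\<Sum>i=1..n. Z i \<omega>\<bar>} \<le> exp (- real p)"
    using sum by (intro prob_abs_ge_le_moment_series[OF _ p(1,2) l series lx]) blast
  also have "\<dots> \<le> exp (- 3 * s)" using p by simp
  also have "\<dots> \<le> 2 * exp (- 3 * s)" by simp
  finally show ?thesis by (simp add: Z_def)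
qed

section \<open>The constants, and the two bounds\<close>

lemma exp_1_ge_2: "exp (1::real) \<ge> 2"
  using exp_ge_add_one_self[of 1] by simp

lemma C_const_ge_8:
  assumes "\<alpha> \<ge> 1" shows "C_const \<alpha> \<ge> 8"
proof -
  have "1 \<le> max (sqrt 2) (2 powr (1 / \<alpha>))" by (simp add: le_max_iff_disj)
  moreover have "8 \<le> 4 * exp 1 + 2 * ln 2 powr (1 / \<alpha>)"
    using exp_1_ge_2 by (intro add_increasing2) auto
  ultimately have "1 * 8 \<le> max (sqrt 2) (2 powr (1 / \<alpha>)) * (4 * exp 1 + 2 * ln 2 powr (1 / \<alpha>))"
    by (intro mult_mono) auto
  with assms show ?thesis by (simp add: C_const_def)
qed

text \<open>
  Apart from absolute factors, \<open>C_const \<alpha>\<close> is \<open>(2 * exp 1) powr (1 / \<alpha>)\<close> times \<open>weibull_scale \<alpha>\<close>.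
  The part \<open>4 powr (1 / \<alpha>)\<close> of it pays for replacing \<open>p\<close> by \<open>16 * s\<close>, together with the factor
  \<open>4 powr (1 / \<alpha>)\<close> in \<open>L_const\<close>.
\<close>

lemma C_const_ge_weibull_scale:
  assumes "0 < \<alpha>" "\<alpha> < 1"
  shows "C_const \<alpha> \<ge> 4 * exp 1 * 4 powr (1 / \<alpha>) * weibull_scale \<alpha>"
proof -
  define g where "g = (exp (2 / exp 1) / \<alpha>) powr (1 / \<alpha>)"
  have g: "g > 0" using assms by (simp add: g_def)
  have A: "weibull_scale \<alpha> = exp 1 * g / exp 1 powr (1 / \<alpha>)"
    using assms by (simp add: weibull_scale_def g_def powr_divide powr_mult)
  have sqrt8: "(2::real) \<le> sqrt 8" by (intro real_le_rsqrt) simp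
  have "1 * 1 \<le> (2 * pi) powr (1 / 4) * exp (1 / 24 :: real)"
    using pi_ge_two by (intro mult_mono ge_one_powr_ge_zero) auto
  then have "sqrt 8 * (exp 1 * exp 1 * exp 1) * (1 * 1)
      \<le> sqrt 8 * (exp 1 * exp 1 * exp 1) * ((2 * pi) powr (1 / 4) * exp (1 / 24))"
    by (intro mult_left_mono) auto
  then have big: "sqrt 8 * (exp 1 * exp 1 * exp 1)
      \<le> sqrt 8 * (exp 1 * exp 1 * exp 1) * ((2 * pi) powr (1 / 4) * exp (1 / 24))" by simp
  have "4 powr (1 / \<alpha>) \<le> (2 * exp 1 :: real) powr (1 / \<alpha>)"
    using assms exp_1_ge_2 by (intro powr_mono2) auto
  then have "4 powr (1 / \<alpha>) / exp 1 powr (1 / \<alpha>) \<le> (2::real) powr (1 / \<alpha>)"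
    by (simp add: powr_mult pos_divide_le_eq)
  then have "(2 * (exp 1 * exp 1 * 2) * g) * (4 powr (1 / \<alpha>) / exp 1 powr (1 / \<alpha>))
      \<le> (sqrt 8 * (exp 1 * exp 1 * exp 1) * g) * 2 powr (1 / \<alpha>)"
    using g sqrt8 exp_1_ge_2 by (intro mult_mono) auto
  also have "\<dots> \<le> (sqrt 8 * (exp 1 * exp 1 * exp 1) * ((2 * pi) powr (1 / 4) * exp (1 / 24)) * g)
      * max (sqrt 2) (2 powr (1 / \<alpha>))"
    using g by (intro mult_mono[OF mult_right_mono[OF big]]) auto
  also have "\<dots> = C_const \<alpha>"
    using assms by (simp add: C_const_def g_def power3_eq_cube mult_ac)
  finally show ?thesis unfolding A by (simp add: mult_ac)
qed

lemma C_const_pos: "\<alpha> > 0 \<Longrightarrow> C_const \<alpha> > 0"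
  by (auto simp: C_const_def less_max_iff_disj intro!: mult_pos_pos add_pos_nonneg)

lemma L_const_nonneg:
  assumes "\<alpha> > 0" "\<exists>i\<in>{1..n}. b i \<noteq> 0"
  shows "L_const n b \<alpha> \<ge> 0"
  unfolding L_const_def
  using C_const_pos[OF assms(1)] lr_norm_2_pos[OF assms(2)] lr_norm_beta_exp_pos[OF assms(2), of \<alpha>]
  by (intro mult_nonneg_nonneg divide_nonneg_nonneg) (auto simp del: numeral_eq_ereal)

lemma L_star_mult:
  assumes "\<exists>i\<in>{1..n}. b i \<noteq> 0"
  shows "L_star n b \<alpha> * lr_norm n (beta_exp \<alpha>) b = L_const n b \<alpha> * C_const \<alpha> * lr_norm n 2 b"
  using lr_norm_beta_exp_pos[OF assms, of \<alpha>] unfolding L_star_def by simp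

text \<open>
  What is left is to compare constants: \<open>\<eta>\<close> and \<open>\<eta> * L_const n b \<alpha>\<close> have to dominate the two
  coefficients in the thresholds of the cases \<open>\<alpha> \<ge> 1\<close> and \<open>\<alpha> < 1\<close>. At \<open>s = 0\<close> the bound is 2.
\<close>

lemma (in prob_space) tail_sum_normalised:
  fixes Y :: "nat \<Rightarrow> 'a \<Rightarrow> real"
  assumes \<alpha>: "\<alpha> > 0" and indep: "indep_vars (\<lambda>_. borel) Y {1..n}"
    and int: "\<And>i. i \<in> {1..n} \<Longrightarrow> integrable M (Y i)"
    and mean: "\<And>i. i \<in> {1..n} \<Longrightarrow> expectation (Y i) = 0"
    and exp2: "\<And>i. i \<in> {1..n} \<Longrightarrow> (\<integral>\<^sup>+\<omega>. ennreal (exp (\<bar>Y i \<omega>\<bar> powr \<alpha>)) \<partial>M) \<le> 2"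
    and b: "\<exists>i\<in>{1..n}. b i \<noteq> 0" and s: "s \<ge> 0"
  defines "\<eta> \<equiv> 2 * exp 1 * C_const \<alpha> * lr_norm n 2 b"
  shows "prob {\<omega> \<in> space M. \<eta> * (sqrt s + L_const n b \<alpha> * s powr (1 / \<alpha>)) \<le> \<bar>\<Sum>i=1..n. b i * Y i \<omega>\<bar>}
    \<le> 2 * exp (- 3 * s)"
proof (cases "s = 0")
  case True
  then show ?thesis using prob_le_1 by (simp add: order_trans[OF prob_le_1])
next
  case False
  then have s: "s > 0" using s by simp
  define N where "N = lr_norm n 2 b"
  define D where "D = lr_norm n (beta_exp \<alpha>) b"
  have N: "N > 0" and D: "D > 0"
    using lr_norm_2_pos[OF b] lr_norm_beta_exp_pos[OF b] by (auto simp: N_def D_def)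
  have C: "C_const \<alpha> > 0" by (rule C_const_pos[OF \<alpha>])
  have sqrt2: "sqrt 2 \<le> (2::real)" by (intro real_le_lsqrt) auto
  have split: "\<eta> * (sqrt s + L_const n b \<alpha> * s powr (1 / \<alpha>))
      = \<eta> * sqrt s + (\<eta> * L_const n b \<alpha>) * s powr (1 / \<alpha>)"
    by (simp add: algebra_simps)
  show ?thesis
  proof (cases "\<alpha> \<ge> 1")
    case True
    show ?thesis
    proof (rule tail_sum_alpha_ge_1[OF True indep int mean exp2 b s])
      have "2 * 2 * 8 \<le> 2 * exp 1 * C_const \<alpha>"
        using exp_1_ge_2 C_const_ge_8[OF True] by (intro mult_mono) auto
      then have "10 * N \<le> \<eta>"
        using N unfolding \<eta>_def N_def[symmetric] by (intro mult_right_mono) auto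
      then have 1: "10 * N * sqrt s \<le> \<eta> * sqrt s" using s by (intro mult_right_mono) auto
      have "10 * 1 \<le> 8 * (2 * 2) / 2 * (4::real) powr (1 / \<alpha>)"
        using \<alpha> by (intro mult_mono ge_one_powr_ge_zero) auto
      also have "\<dots> \<le> 8 * (exp 1 * exp 1) / sqrt 2 * 4 powr (1 / \<alpha>)"
        using exp_1_ge_2 sqrt2 by (intro mult_right_mono frac_le mult_left_mono mult_mono) auto
      finally have "10 * D \<le> 8 * (exp 1 * exp 1) / sqrt 2 * 4 powr (1 / \<alpha>) * D"
        using D by (intro mult_right_mono) auto
      also have "\<dots> = \<eta> * L_const n b \<alpha>"
        using True N C unfolding \<eta>_def L_const_def N_def[symmetric] D_def[symmetric] by simp
      finally have "10 * D * s powr (1 / \<alpha>) \<le> \<eta> * L_const n b \<alpha> * s powr (1 / \<alpha>)"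
        by (intro mult_right_mono) auto
      with 1 show "10 * lr_norm n 2 b * sqrt s + 10 * lr_norm n (beta_exp \<alpha>) b * s powr (1 / \<alpha>)
          \<le> \<eta> * (sqrt s + L_const n b \<alpha> * s powr (1 / \<alpha>))"
        unfolding split N_def[symmetric] D_def[symmetric] by linarith
    qed auto
  next
    case False
    then have \<alpha>1: "\<alpha> < 1" by simp
    define A where "A = weibull_scale \<alpha>"
    have A: "A > 0" using \<alpha> by (simp add: A_def weibull_scale_pos)
    have CA: "4 * exp 1 * 4 powr (1 / \<alpha>) * A \<le> C_const \<alpha>"
      unfolding A_def by (rule C_const_ge_weibull_scale[OF \<alpha> \<alpha>1])
    have e2: "exp 2 = exp 1 * exp (1::real)" by (simp flip: exp_add)
    have D_inf: "D = lr_norm n \<infinity> b" using \<alpha>1 by (simp add: D_def beta_exp_def)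
    show ?thesis
    proof (rule tail_sum_alpha_less_1[OF \<alpha> \<alpha>1 indep mean exp2 b s])
      have "2 * exp 1 * (4 * exp 1 * 1 * A) \<le> 2 * exp 1 * (4 * exp 1 * 4 powr (1 / \<alpha>) * A)"
        using \<alpha> A by (intro mult_left_mono mult_right_mono ge_one_powr_ge_zero) auto
      also have "\<dots> \<le> 2 * exp 1 * C_const \<alpha>" by (intro mult_left_mono CA) auto
      finally have "2 * exp 1 * (4 * exp 1 * 1 * A) * N \<le> \<eta>"
        using N unfolding \<eta>_def N_def[symmetric] by (intro mult_right_mono) auto
      then have "2 * exp 1 * (4 * exp 1 * 1 * A) * N * sqrt s \<le> \<eta> * sqrt s"
        using s by (intro mult_right_mono) auto
      then have 1: "8 * exp 2 * A * N * sqrt s \<le> \<eta> * sqrt s" by (simp add: e2 mult_ac)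
      have "2 * exp 2 * 16 powr (1 / \<alpha>) * A * D = (exp 1 * 4 powr (1 / \<alpha>) * D / 2) * (4 * exp 1 * 4 powr (1 / \<alpha>) * A)"
        using powr_mult[of 4 4 "1 / \<alpha>"] by (simp add: e2)
      also have "\<dots> \<le> (exp 1 * 4 powr (1 / \<alpha>) * D / 2) * C_const \<alpha>"
        using D by (intro mult_left_mono CA) auto
      also have "\<dots> \<le> (2 * exp 1 * 4 powr (1 / \<alpha>) * D / sqrt 2) * C_const \<alpha>"
        using C D sqrt2 by (intro mult_right_mono frac_le) auto
      also have "\<dots> = \<eta> * L_const n b \<alpha>"
        using \<alpha>1 N unfolding \<eta>_def L_const_def N_def[symmetric] D_def[symmetric] by simp
      finally have "2 * exp 2 * 16 powr (1 / \<alpha>) * A * D * s powr (1 / \<alpha>)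
          \<le> \<eta> * L_const n b \<alpha> * s powr (1 / \<alpha>)"
        by (intro mult_right_mono) auto
      with 1 show "8 * exp 2 * weibull_scale \<alpha> * lr_norm n 2 b * sqrt s
          + 2 * exp 2 * 16 powr (1 / \<alpha>) * weibull_scale \<alpha> * lr_norm n \<infinity> b * s powr (1 / \<alpha>)
          \<le> \<eta> * (sqrt s + L_const n b \<alpha> * s powr (1 / \<alpha>))"
        unfolding split N_def[symmetric] D_inf[symmetric] A_def[symmetric] by linarith
    qed auto
  qed
qed

theorem theorem3p1:
  fixes M :: "'w measure" and n :: nat and X :: "nat \<Rightarrow> 'w \<Rightarrow> real"
    and a b :: "nat \<Rightarrow> real" and \<alpha> :: real
  assumes "prob_space M"
    and "\<alpha> > 0"
    and "prob_space.indep_vars M (\<lambda>_. borel) X {1..n}"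
    and "\<And>i. i \<in> {1..n} \<Longrightarrow> integrable M (X i)"
    and "\<And>i. i \<in> {1..n} \<Longrightarrow> prob_space.expectation M (X i) = 0"
    and "\<And>i. i \<in> {1..n} \<Longrightarrow> orlicz_norm M (psi \<alpha>) (X i) < \<infinity>"
    and "\<And>i. i \<in> {1..n} \<Longrightarrow> b i = a i * enn2real (orlicz_norm M (psi \<alpha>) (X i))"
    and "\<exists>i\<in>{1..n}. b i \<noteq> 0"
  shows "orlicz_norm M (Psi \<alpha> (L_const n b \<alpha>)) (\<lambda>\<omega>. \<Sum>i=1..n. a i * X i \<omega>)
           \<le> ennreal (2 * exp 1 * C_const \<alpha> * lr_norm n 2 b)
    \<and> (\<forall>t\<ge>0. prob_space.prob M {\<omega> \<in> space M.
           \<bar>\<Sum>i=1..n. a i * X i \<omega>\<bar>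
             \<ge> 2 * exp 1 * C_const \<alpha> * lr_norm n 2 b * sqrt t
                + 2 * exp 1 * L_star n b \<alpha> * t powr (1 / \<alpha>) * lr_norm n (beta_exp \<alpha>) b}
         \<le> 2 * exp (- t))"
proof -
  interpret prob_space M by (rule assms(1))
  note \<alpha> = assms(2) and indep = assms(3) and int = assms(4) and mean = assms(5)
    and fin = assms(6) and b_eq = assms(7) and b = assms(8)
  define K where "K i = enn2real (orlicz_norm M (psi \<alpha>) (X i))" for i
  define Y where "Y i \<omega> = X i \<omega> / K i" for i \<omega>
  define \<eta> where "\<eta> = 2 * exp 1 * C_const \<alpha> * lr_norm n 2 b"
  define L where "L = L_const n b \<alpha>"
  define S where "S \<omega> = (\<Sum>i=1..n. a i * X i \<omega>)" for \<omega>
  have meas[measurable]: "X i \<in> borel_measurable M" if "i \<in> {1..n}" for i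
    using int[OF that] by auto
  have S[measurable]: "S \<in> borel_measurable M" unfolding S_def by measurable
  have [measurable]: "Y i \<in> borel_measurable M" if "i \<in> {1..n}" for i
    using that unfolding Y_def by measurable
  have \<eta>: "\<eta> > 0" using C_const_pos[OF \<alpha>] lr_norm_2_pos[OF b] unfolding \<eta>_def by simp
  have X_eq: "AE \<omega> in M. X i \<omega> = K i * Y i \<omega>" if i: "i \<in> {1..n}" for i
  proof (cases "K i = 0")
    case True
    then have "orlicz_norm M (psi \<alpha>) (X i) = 0"
      using fin[OF i] by (auto simp: K_def enn2real_eq_0_iff)
    from AE_eq_0_if_orlicz_norm_eq_0[OF \<alpha> meas[OF i] this] show ?thesis
      using True by simp
  qed (simp add: Y_def)
  have "AE \<omega> in M. \<forall>i\<in>{1..n}. X i \<omega> = K i * Y i \<omega>"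
    using X_eq by (intro AE_finite_allI) auto
  then have S_eq: "AE \<omega> in M. S \<omega> = (\<Sum>i=1..n. b i * Y i \<omega>)"
    by eventually_elim (auto simp: S_def b_eq K_def[symmetric] intro!: sum.cong)
  have indepY: "indep_vars (\<lambda>_. borel) Y {1..n}"
    unfolding Y_def by (rule indep_vars_compose2[OF indep]) auto
  have tail: "prob {\<omega> \<in> space M. \<eta> * (sqrt s + L * s powr (1 / \<alpha>)) \<le> \<bar>S \<omega>\<bar>} \<le> 2 * exp (- 3 * s)"
    if s: "s \<ge> 0" for s
  proof -
    have "prob {\<omega> \<in> space M. \<eta> * (sqrt s + L * s powr (1 / \<alpha>)) \<le> \<bar>S \<omega>\<bar>}
        = prob {\<omega> \<in> space M. \<eta> * (sqrt s + L * s powr (1 / \<alpha>)) \<le> \<bar>\<Sum>i=1..n. b i * Y i \<omega>\<bar>}"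
      using S_eq by (intro finite_measure_eq_AE) auto
    also have "\<dots> \<le> 2 * exp (- 3 * s)"
      unfolding \<eta>_def L_def
    proof (rule tail_sum_normalised[OF \<alpha> indepY _ _ _ b s])
      fix i assume i: "i \<in> {1..n}"
      show "integrable M (Y i)" using int[OF i] by (simp add: Y_def[abs_def])
      show "expectation (Y i) = 0" using mean[OF i] by (simp add: Y_def[abs_def])
      show "(\<integral>\<^sup>+\<omega>. ennreal (exp (\<bar>Y i \<omega>\<bar> powr \<alpha>)) \<partial>M) \<le> 2"
        unfolding Y_def K_def by (rule nn_integral_exp_normalised_le_2[OF \<alpha> meas[OF i] fin[OF i]])
    qed
    finally show ?thesis .
  qed
  have "orlicz_norm M (Psi \<alpha> L) S \<le> ennreal \<eta>"
    using L_const_nonneg[OF \<alpha> b] tail unfolding L_def[symmetric]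
    by (intro orlicz_norm_Psi_le_if_tail[OF \<alpha> _ \<eta> S]) auto
  moreover have "prob {\<omega> \<in> space M. \<bar>S \<omega>\<bar> \<ge> \<eta> * sqrt t
      + 2 * exp 1 * L_star n b \<alpha> * t powr (1 / \<alpha>) * lr_norm n (beta_exp \<alpha>) b} \<le> 2 * exp (- t)"
    if t: "t \<ge> 0" for t
  proof -
    have "2 * exp 1 * L_star n b \<alpha> * t powr (1 / \<alpha>) * lr_norm n (beta_exp \<alpha>) b
        = 2 * exp 1 * t powr (1 / \<alpha>) * (L_star n b \<alpha> * lr_norm n (beta_exp \<alpha>) b)" by simp
    also have "\<dots> = \<eta> * (L * t powr (1 / \<alpha>))"
      unfolding L_star_mult[OF b] \<eta>_def L_def by simp
    finally have second: "2 * exp 1 * L_star n b \<alpha> * t powr (1 / \<alpha>) * lr_norm n (beta_exp \<alpha>) b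
        = \<eta> * (L * t powr (1 / \<alpha>))" .
    have "prob {\<omega> \<in> space M. \<bar>S \<omega>\<bar> \<ge> \<eta> * sqrt t
        + 2 * exp 1 * L_star n b \<alpha> * t powr (1 / \<alpha>) * lr_norm n (beta_exp \<alpha>) b}
        = prob {\<omega> \<in> space M. \<eta> * (sqrt t + L * t powr (1 / \<alpha>)) \<le> \<bar>S \<omega>\<bar>}"
      unfolding second distrib_left ..
    also have "\<dots> \<le> 2 * exp (- 3 * t)" by (rule tail[OF t])
    also have "\<dots> \<le> 2 * exp (- t)" using t by simp
    finally show ?thesis .
  qed
  ultimately show ?thesis unfolding S_def L_def \<eta>_def by blast
qed

end
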